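(* Let $\delta>0$, let $\mathcal{X}$ be a non-empty $\delta$-well spaced subset of $\mathbb{R}/\mathbb{Z}$, and let $N\ge 1000$ and $M\ge 0$ be real numbers. Let $(u_p)_{M+1\le p\le M+N}$ be a sequence of complex numbers indexed by the primes in $[M+1,M+N]$. Then $$\sum_{x\in\mathcal{X}}\Bigl|\sum_{M+1\le p\le M+N}u_p e(xp)\Bigr|^2\le 280\,\frac{N+\delta^{-1}}{\log N}\Bigl(\sum_{M+1\le p\le M+N}|u_p|^2\Bigr)\log(2|\mathcal{X}|).$$
   Context: The variable $p$ always denotes a prime number, and sums over $p$ run over primes. We write $e(\alpha)=\exp(2i\pi\alpha)$, and $|y|_{\mathbb{Z}}=\min_{k\in\mathbb{Z}}|y-k|$ for the distance of $y$ to the nearest integer. A set $\mathcal{X}\subset\mathbb{R}/\mathbb{Z}$ is called $\delta$-well spaced when $|x-x'|_{\mathbb{Z}}\ge\delta$ for all distinct $x,x'\in\mathcal{X}$ (such a set is finite); $|\mathcal{X}|$ is its cardinality. *)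

theory Defs
  imports
    "HOL-Analysis.Analysis"
    "HOL-Computational_Algebra.Primes"
    "HOL-Library.Real_Mod"
begin

text \<open>\<open>circle\<close> is \<open>\<real>/\<int>\<close>; the maps on it below are induced from the reals.\<close>

quotient_type circle = real / "\<lambda>x y. [x = y] (rmod 1)"
  by (intro equivpI reflpI sympI transpI) (auto intro: rcong_sym rcong_trans)

instantiation circle :: ab_group_add
begin

lift_definition zero_circle :: circle is 0 .

lift_definition plus_circle :: "circle \<Rightarrow> circle \<Rightarrow> circle" is "(+)"
  by (rule rcong_intros)

lift_definition uminus_circle :: "circle \<Rightarrow> circle" is uminus
  by (simp add: rcong_uminus_uminus_iff)

lift_definition minus_circle :: "circle \<Rightarrow> circle \<Rightarrow> circle" is "(-)"
  by (rule rcong_intros)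

instance
  by standard (transfer; simp add: algebra_simps)+

end

lemma rcong_1_iff: "[x = y] (rmod 1) \<longleftrightarrow> (\<exists>k::int. y = x + of_int k)"
  by (auto simp: rcong_altdef)

lift_definition nat_mult :: "nat \<Rightarrow> circle \<Rightarrow> circle" is "\<lambda>n x. of_nat n * x"
proof -
  fix n :: nat and x y :: real
  assume "[x = y] (rmod 1)"
  then obtain k :: int where "y = x + of_int k"
    by (auto simp: rcong_1_iff)
  then have "of_nat n * y = of_nat n * x + of_int (int n * k)"
    by (simp add: algebra_simps)
  then show "[of_nat n * x = of_nat n * y] (rmod 1)"
    unfolding rcong_1_iff by blast
qed

lemma nat_mult_0: "nat_mult 0 x = 0"
  by transfer simp

lemma nat_mult_Suc: "nat_mult (Suc n) x = x + nat_mult n x"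
  by transfer (simp add: algebra_simps)

lift_definition e :: "circle \<Rightarrow> complex"
  is "\<lambda>\<alpha>. exp (2 * \<i> * of_real pi * of_real \<alpha>)"
proof -
  fix x y :: real
  assume "[x = y] (rmod 1)"
  then obtain k :: int where k: "y = x + of_int k"
    by (auto simp: rcong_1_iff)
  show "exp (2 * \<i> * of_real pi * of_real x) = exp (2 * \<i> * of_real pi * of_real y)"
    unfolding exp_eq by (rule exI[of _ "-k"]) (simp add: k algebra_simps)
qed

text \<open>The distance \<open>|y|\<close> to the nearest integer; the infimum is a minimum, see \<open>dist_int_attained\<close>.\<close>

definition dist_int :: "real \<Rightarrow> real"
  where "dist_int y = (INF k::int. \<bar>y - of_int k\<bar>)"

lemma dist_int_attained:
  "\<exists>k::int. dist_int y = \<bar>y - of_int k\<bar> \<and> (\<forall>l::int. \<bar>y - of_int k\<bar> \<le> \<bar>y - of_int l\<bar>)"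
proof (intro exI conjI allI)
  show le: "\<bar>y - of_int (round y)\<bar> \<le> \<bar>y - of_int l\<bar>" for l :: int
    using round_diff_minimal[of y l] .
  show "dist_int y = \<bar>y - of_int (round y)\<bar>"
    unfolding dist_int_def by (rule cInf_eq_minimum) (use le in auto)
qed

lift_definition circle_norm :: "circle \<Rightarrow> real" is dist_int
proof -
  fix x y :: real
  assume "[x = y] (rmod 1)"
  then obtain k :: int where k: "y = x + of_int k"
    by (auto simp: rcong_1_iff)
  have "range (\<lambda>l::int. \<bar>x - of_int l\<bar>) = range (\<lambda>l::int. \<bar>y - of_int l\<bar>)"
  proof (intro equalityI subsetI)
    fix z assume "z \<in> range (\<lambda>l::int. \<bar>x - of_int l\<bar>)"
    then obtain l :: int where "z = \<bar>x - of_int l\<bar>" by blast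
    then have "z = \<bar>y - of_int (l + k)\<bar>" by (simp add: k)
    then show "z \<in> range (\<lambda>l::int. \<bar>y - of_int l\<bar>)" by blast
  next
    fix z assume "z \<in> range (\<lambda>l::int. \<bar>y - of_int l\<bar>)"
    then obtain l :: int where "z = \<bar>y - of_int l\<bar>" by blast
    then have "z = \<bar>x - of_int (l - k)\<bar>" by (simp add: k algebra_simps)
    then show "z \<in> range (\<lambda>l::int. \<bar>x - of_int l\<bar>)" by blast
  qed
  then show "dist_int x = dist_int y"
    by (simp add: dist_int_def)
qed

definition well_spaced :: "real \<Rightarrow> circle set \<Rightarrow> bool"
  where "well_spaced \<delta> X \<longleftrightarrow> (\<forall>x\<in>X. \<forall>x'\<in>X. x \<noteq> x' \<longrightarrow> circle_norm (x - x') \<ge> \<delta>)"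

lemma circle_norm_le: "circle_norm (abs_circle y) \<le> \<bar>y\<bar>"
proof -
  obtain k :: int where "dist_int y = \<bar>y - of_int k\<bar>" "\<forall>l::int. \<bar>y - of_int k\<bar> \<le> \<bar>y - of_int l\<bar>"
    using dist_int_attained by blast
  then have "dist_int y \<le> \<bar>y - of_int 0\<bar>" by metis
  then show ?thesis by (simp add: circle_norm.abs_eq)
qed

lemma well_spaced_finite:
  assumes "\<delta> > 0" and "well_spaced \<delta> X"
  shows "finite X"
proof -
  define r where "r x = frac (rep_circle x)" for x
  have abs_r: "abs_circle (r x) = x" for x
  proof -
    have "[rep_circle x = r x] (rmod 1)"
      unfolding rcong_1_iff r_def
      by (rule exI[of _ "- \<lfloor>rep_circle x\<rfloor>"]) (simp add: frac_def)
    then have "abs_circle (rep_circle x) = abs_circle (r x)"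
      by (simp add: circle.abs_eq_iff)
    then show ?thesis
      by (metis Quotient3_abs_rep Quotient3_circle)
  qed
  have "inj_on (\<lambda>x. \<lfloor>r x / \<delta>\<rfloor>) X"
  proof (rule inj_onI, rule ccontr)
    fix x y assume xy: "x \<in> X" "y \<in> X" "\<lfloor>r x / \<delta>\<rfloor> = \<lfloor>r y / \<delta>\<rfloor>" "x \<noteq> y"
    have "\<bar>r x / \<delta> - r y / \<delta>\<bar> < 1" using xy(3) by linarith
    then have lt: "\<bar>r x - r y\<bar> < \<delta>"
      using \<open>\<delta> > 0\<close> by (simp add: diff_divide_distrib[symmetric] abs_divide)
    have "x - y = abs_circle (r x - r y)"
      by (metis abs_r minus_circle.abs_eq)
    then have "circle_norm (x - y) < \<delta>"
      using circle_norm_le[of "r x - r y"] lt by simp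
    then show False
      using assms(2) xy by (force simp: well_spaced_def)
  qed
  moreover have "(\<lambda>x. \<lfloor>r x / \<delta>\<rfloor>) ` X \<subseteq> {0..\<lfloor>1 / \<delta>\<rfloor>}"
  proof (rule image_subsetI)
    fix x
    have "0 \<le> r x" "r x \<le> 1" by (simp_all add: r_def frac_lt_1 less_imp_le)
    then have "0 \<le> r x / \<delta>" "r x / \<delta> \<le> 1 / \<delta>"
      using \<open>\<delta> > 0\<close> by (simp_all add: divide_right_mono)
    then show "\<lfloor>r x / \<delta>\<rfloor> \<in> {0..\<lfloor>1 / \<delta>\<rfloor>}" by (simp add: floor_mono)
  qed
  ultimately show ?thesis
    by (meson finite_atLeastAtMost_int inj_on_finite)
qed

definition primes_between :: "real \<Rightarrow> real \<Rightarrow> nat set"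
  where "primes_between a b = {p. prime p \<and> a \<le> real p \<and> real p \<le> b}"

lemma finite_primes_between: "finite (primes_between a b)"
proof (rule finite_subset)
  show "primes_between a b \<subseteq> {..nat \<lfloor>b\<rfloor>}"
    by (auto simp: primes_between_def le_nat_floor)
qed simp

end

theory Submission
  imports Defs "HOL-Number_Theory.Totient" "HOL-Computational_Algebra.Squarefree"
begin

text \<open>
  The inequality is proved in its dual form: for all complex \<open>b\<close>, and with
  \<open>B n = \<Sum>x. b x e(x n)\<close>, the sum of \<open>\<bar>B p\<bar>\<^sup>2\<close> over the primes of the window is at most the
  stated constant times \<open>\<Sum>\<bar>b x\<bar>\<^sup>2\<close> (\<open>dual_inequality\<close>; the passage back is \<open>duality\<close>). Let
  \<open>k\<close> be the number of points and let the integer \<open>H\<close> be about \<open>N + 1/\<delta>\<close>. Summing over all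
  integers of the window instead of the primes gives the bound \<open>3 H\<close> (\<open>large_sieve\<close>), which is good
  enough as soon as \<open>ln (2 k)\<close> is at least a small multiple of \<open>ln N\<close>. The content is
  the opposite case, where \<open>k\<close> is at most a small power of \<open>N\<close>.

  Then the primes are detected by the trigonometric polynomial
  \<open>A n = (1/G) \<Sum>r. \<mu>(r)/\<phi>(r) c\<^sub>r(n)\<close>, where \<open>c\<^sub>r\<close> is the Ramanujan sum, \<open>r\<close> runs over
  the squarefree numbers up to \<open>Z = N\<^bsup>1/4\<^esup>\<close> all of whose prime factors exceed a level \<open>y\<close>,
  and \<open>G = \<Sum>r. 1/\<phi>(r)\<close>. If \<open>n\<close> is coprime to all these \<open>r\<close>, in particular if \<open>n\<close> is a
  prime larger than \<open>Z\<close>, then \<open>c\<^sub>r(n) = \<mu>(r)\<close> and \<open>A n = 1\<close>. Hence \<open>\<bar>B p\<bar>\<^sup>2\<close> may be replaced by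
  \<open>\<bar>A p B p\<bar>\<^sup>2\<close> and the sum extended to all integers of the window. The product \<open>A B\<close> has the
  frequencies \<open>x + a/r\<close>, and the resulting quadratic form splits in two. Pairs with equal \<open>a/r\<close>
  contribute the ordinary large sieve times \<open>\<Sum>\<phi>(r) (1/(G \<phi>(r)))\<^sup>2 = 1/G\<close>: a saving of \<open>G\<close>.
  Pairs with \<open>a/r - a'/r' = \<psi> \<noteq> 0\<close> are controlled by the correlation of the coefficients
  of \<open>A\<close> at the shift \<open>\<psi>\<close>. As \<open>\<psi> \<noteq> 0\<close>, some prime divides \<open>r\<close> or \<open>r'\<close> in each
  such pair, and this prime exceeds \<open>y\<close>; so the correlation is at most \<open>2/(G \<surd>y)\<close>
  (\<open>correlation_le\<close>). The differences \<open>\<psi>\<close> are spaced by \<open>Z\<^bsup>-4\<^esup> \<ge> 1/H\<close>, so summing over them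
  costs only a factor of order \<open>H\<close>, and summing over the points a factor \<open>k\<close>. Altogether the bound is
  \<open>(H/G) (3 + 10 k/\<surd>y)\<close> (\<open>enveloping_sieve_bound\<close>).

  With \<open>y\<close> about \<open>k\<^sup>2\<close> the bracket is bounded. Sifting only by the primes above
  \<open>y\<close> divides the usual lower bound \<open>ln Z\<close> for \<open>G\<close> by \<open>\<Prod>p/(p - 1)\<close>, \<open>p\<close> running over the
  primes up to \<open>y\<close> (\<open>ln_le_sieve_sum\<close>), and by Mertens this product is at most a constant times \<open>ln y\<close>
  (\<open>mertens_product_le\<close>), that is, a constant times \<open>ln (2 k)\<close>. This is the logarithm in the theorem.
  For the few smallest values of \<open>k\<close> the choice \<open>y = 1\<close> gives a better constant
  (\<open>exists_sifting_level\<close>).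
\<close>

section \<open>Exponential sums over spaced points\<close>

text \<open>The exponential \<open>e\<close> of the circle, lifted to \<open>\<real>\<close>.\<close>
definition ee :: "real \<Rightarrow> complex"
  where "ee t = cis (2 * pi * t)"

lemma ee_add: "ee (s + t) = ee s * ee t"
  by (simp add: ee_def cis_mult distrib_left)

lemma cnj_ee: "cnj (ee t) = ee (- t)"
  by (simp add: ee_def cis_cnj)

lemma cmod_ee [simp]: "cmod (ee t) = 1"
  by (simp add: ee_def)

lemma ee_of_int [simp]: "ee (of_int k) = 1"
  by (simp add: ee_def cis_multiple_2pi)

lemma ee_of_nat [simp]: "ee (of_nat k) = 1"
  using ee_of_int[of "int k"] by simp

lemma ee_mult_nat: "ee (of_nat k * t) = ee t ^ k"
  unfolding ee_def Complex.DeMoivre by (rule arg_cong[of _ _ cis]) simp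

lemma dist_int_eq_round: "dist_int t = \<bar>t - of_int (round t)\<bar>"
  unfolding dist_int_def
  by (rule cInf_eq_minimum) (use round_diff_minimal[of t] in auto)

lemma dist_int_le: "dist_int t \<le> \<bar>t - of_int k\<bar>"
  unfolding dist_int_eq_round by (rule round_diff_minimal)

lemma dist_int_nonneg: "dist_int t \<ge> 0"
  by (simp add: dist_int_eq_round)

lemma dist_int_le_half: "dist_int t \<le> 1 / 2"
  using of_int_round_abs_le[of t] by (simp add: dist_int_eq_round abs_minus_commute)

lemma dist_int_eq_diff_int: obtains k where "dist_int t = \<bar>t - of_int k\<bar>"
  using dist_int_eq_round by blast

text \<open>The graph of a concave function lies above its chord from \<open>0\<close> to \<open>pi / 2\<close>.\<close>
lemma sin_ge_linear:
  assumes "0 \<le> x" "x \<le> pi / 2" shows "2 / pi * x \<le> sin x"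
proof -
  have "concave_on {0..pi} sin"
    by (rule f''_le0_imp_concave[where f' = cos and f'' = "\<lambda>x. - sin x"])
      (auto intro!: derivative_eq_intros sin_ge_zero)
  then have "(1 - 2 / pi * x) * sin 0 + (2 / pi * x) * sin (pi / 2)
      \<le> sin ((1 - 2 / pi * x) *\<^sub>R 0 + (2 / pi * x) *\<^sub>R (pi / 2))"
    using assms by (intro concave_onD) (auto simp: field_simps)
  then show ?thesis by simp
qed

lemma cmod_ee_minus_1: "4 * dist_int t \<le> cmod (ee t - 1)"
proof -
  obtain k :: int where k: "dist_int t = \<bar>t - of_int k\<bar>" by (rule dist_int_eq_diff_int)
  define s where "s = \<bar>t - of_int k\<bar>"
  have s: "0 \<le> s" "s \<le> 1 / 2"
    using dist_int_le_half[of t] k by (auto simp: s_def)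
  have "ee t = ee (t - of_int k)"
    using ee_add[of "t - of_int k" "of_int k"] by simp
  then have "cmod (ee t - 1) = 2 * \<bar>sin (2 * pi * (t - of_int k) / 2)\<bar>"
    using dist_exp_i_1[of "2 * pi * (t - of_int k)"] by (simp add: ee_def cis_conv_exp)
  also have "\<dots> = 2 * \<bar>sin (pi * s)\<bar>"
  proof -
    have "pi * s = 2 * pi * (t - of_int k) / 2 \<or> pi * s = - (2 * pi * (t - of_int k) / 2)"
      by (auto simp: s_def abs_if field_simps)
    then show ?thesis by (elim disjE) (simp_all only: sin_minus abs_minus_cancel)
  qed
  finally have "cmod (ee t - 1) = 2 * \<bar>sin (pi * s)\<bar>" .
  moreover have "2 * s \<le> sin (pi * s)"
    using sin_ge_linear[of "pi * s"] s by simp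
  ultimately show ?thesis using k by (simp add: s_def)
qed

definition geo :: "nat \<Rightarrow> real \<Rightarrow> complex"
  where "geo K t = (\<Sum>k<K. ee (real k * t))"

lemma cmod_geo_le: "cmod (geo K t) \<le> real K"
  unfolding geo_def by (rule order_trans[OF norm_sum]) simp

lemma cmod_geo_dist_int: "2 * dist_int t * cmod (geo K t) \<le> 1"
proof -
  have "geo K t * (ee t - 1) = ee t ^ K - 1"
    unfolding geo_def ee_mult_nat power_diff_1_eq by (simp add: mult.commute)
  then have "cmod (geo K t) * cmod (ee t - 1) = cmod (ee t ^ K - 1)"
    by (metis norm_mult)
  also have "\<dots> \<le> 2"
    using norm_triangle_ineq4[of "ee t ^ K" 1] by (simp add: norm_power)
  finally have *: "cmod (geo K t) * cmod (ee t - 1) \<le> 2" .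
  have "cmod (geo K t) * (4 * dist_int t) \<le> cmod (geo K t) * cmod (ee t - 1)"
    by (intro mult_left_mono cmod_ee_minus_1) auto
  with * show ?thesis by (simp add: algebra_simps)
qed

lemma geo_add_int: "geo K (t + of_int k) = geo K t"
proof -
  have "ee (real j * (t + of_int k)) = ee (real j * t)" for j
    using ee_of_int[of "int j * k"] by (simp add: distrib_left ee_add)
  then show ?thesis by (simp add: geo_def)
qed

lemma geo_minus: "geo K (- t) = cnj (geo K t)"
  by (simp add: geo_def cnj_ee)

text \<open>
  A majorant of Fejer type. A product of two geometric sums decays quadratically away from the
  integers and is therefore summable over well spaced points. Taking them of different lengths,
  \<open>2 H\<close> and \<open>H\<close>, corresponds to a trapezoidal weight, which is constant on a window of
  \<open>H + 1\<close> integers.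
\<close>
definition kern :: "nat \<Rightarrow> real \<Rightarrow> real"
  where "kern H t = cmod (geo (2 * H) t) * cmod (geo H t) / real H"

lemma kern_nonneg: "kern H t \<ge> 0"
  by (simp add: kern_def)

lemma kern_minus: "kern H (- t) = kern H t"
  by (simp add: kern_def geo_minus)

lemma kern_add_int: "kern H (t + of_int k) = kern H t"
  by (simp add: kern_def geo_add_int)

lemma kern_le: 
  assumes "H > 0" shows "kern H t \<le> 2 * real H"
proof -
  have "cmod (geo (2 * H) t) * cmod (geo H t) \<le> real (2 * H) * real H"
    by (intro mult_mono cmod_geo_le) auto
  with assms show ?thesis by (simp add: kern_def field_simps)
qed

lemma kern_dist_int:
  assumes "H > 0" shows "4 * real H * (dist_int t)\<^sup>2 * kern H t \<le> 1"
proof -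
  have "(2 * dist_int t * cmod (geo (2 * H) t)) * (2 * dist_int t * cmod (geo H t)) \<le> 1 * 1"
    by (intro mult_mono cmod_geo_dist_int) (auto simp: dist_int_nonneg)
  with assms show ?thesis
    by (simp add: kern_def field_simps power2_eq_square)
qed

text \<open>
  Averaging over translates: for every \<open>l < H\<close> the window \<open>m, \<dots>, m + H\<close> is contained in the window
  \<open>m - l, \<dots>, m - l + 2 H - 1\<close>. Summing over all these longer windows makes both \<open>k\<close> and \<open>l\<close> run
  freely in the phase \<open>m + k - l\<close>, so the exponential sums factor into two geometric sums.
\<close>
lemma mean_square_le_kern:
  fixes c :: "'i \<Rightarrow> complex" and t :: "'i \<Rightarrow> real" and m :: int
  assumes I: "finite I" and H: "H > 0"
  shows "(\<Sum>n\<le>H. (cmod (\<Sum>i\<in>I. c i * ee (of_int (m + int n) * t i)))\<^sup>2)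
    \<le> (\<Sum>i\<in>I. \<Sum>j\<in>I. cmod (c i) * cmod (c j) * kern H (t i - t j))"
proof -
  define g where "g n = (cmod (\<Sum>i\<in>I. c i * ee (of_int n * t i)))\<^sup>2" for n :: int
  have g: "complex_of_real (g n) = (\<Sum>i\<in>I. \<Sum>j\<in>I. c i * cnj (c j) * ee (of_int n * (t i - t j)))" for n
  proof -
    have "complex_of_real (g n)
        = (\<Sum>i\<in>I. c i * ee (of_int n * t i)) * cnj (\<Sum>i\<in>I. c i * ee (of_int n * t i))"
      unfolding g_def by (rule complex_norm_square)
    also have "\<dots> = (\<Sum>i\<in>I. \<Sum>j\<in>I. c i * cnj (c j) * ee (of_int n * (t i - t j)))"
    proof -
      have "ee (of_int n * t i) * ee (- (of_int n * t j)) = ee (of_int n * (t i - t j))" for i j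
        by (simp add: algebra_simps flip: ee_add)
      then show ?thesis by (simp add: sum_product cnj_ee mult_ac)
    qed
    finally show ?thesis .
  qed
  define V where "V = (\<Sum>l<H. \<Sum>k<2 * H. g (m + int k - int l))"
  have "real H * (\<Sum>n\<le>H. g (m + int n)) = (\<Sum>l<H. \<Sum>n\<le>H. g (m + int n))" by simp
  also have "\<dots> \<le> V"
    unfolding V_def
  proof (intro sum_mono)
    fix l assume l: "l \<in> {..<H}"
    \<comment> \<open>The indices \<open>k = n + l\<close> stay below \<open>2 H\<close> because \<open>n \<le> H\<close> and \<open>l < H\<close>.\<close>
    have "(\<Sum>n\<le>H. g (m + int n)) = (\<Sum>k\<in>(\<lambda>n. n + l) ` {..H}. g (m + int k - int l))"
      by (subst sum.reindex) auto
    also have "\<dots> \<le> (\<Sum>k<2 * H. g (m + int k - int l))"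
      using l by (intro sum_mono2) (auto simp: g_def)
    finally show "(\<Sum>n\<le>H. g (m + int n)) \<le> (\<Sum>k<2 * H. g (m + int k - int l))" .
  qed
  also have "V = cmod (complex_of_real V)"
  proof -
    have "V \<ge> 0" unfolding V_def g_def by (intro sum_nonneg) auto
    then show ?thesis by simp
  qed
  also have "complex_of_real V = (\<Sum>l<H. \<Sum>k<2 * H. \<Sum>i\<in>I. \<Sum>j\<in>I.
      c i * cnj (c j) * ee (of_int (m + int k - int l) * (t i - t j)))"
    unfolding V_def of_real_sum g ..
  also have "\<dots> = (\<Sum>i\<in>I. \<Sum>j\<in>I. \<Sum>l<H. \<Sum>k<2 * H.
      c i * cnj (c j) * ee (of_int (m + int k - int l) * (t i - t j)))"
    by (subst (2) sum.swap, subst sum.swap, rule sum.cong[OF refl],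
        subst (2) sum.swap, subst sum.swap, rule refl)
  also have "\<dots> = (\<Sum>i\<in>I. \<Sum>j\<in>I. c i * cnj (c j) * ee (of_int m * (t i - t j))
      * geo (2 * H) (t i - t j) * cnj (geo H (t i - t j)))"
  proof (intro sum.cong refl)
    fix i j
    have "ee (of_int (m + int k - int l) * s)
        = ee (of_int m * s) * ee (real k * s) * ee (- (real l * s))" for k l s
      by (simp add: algebra_simps flip: ee_add)
    then show "(\<Sum>l<H. \<Sum>k<2 * H. c i * cnj (c j) * ee (of_int (m + int k - int l) * (t i - t j)))
      = c i * cnj (c j) * ee (of_int m * (t i - t j))
      * geo (2 * H) (t i - t j) * cnj (geo H (t i - t j))"
      unfolding geo_def
      by (subst sum.swap) (simp add: sum_product sum_distrib_left cnj_ee mult_ac)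
  qed
  also have "cmod \<dots> \<le> (\<Sum>i\<in>I. \<Sum>j\<in>I. cmod (c i) * cmod (c j) * (real H * kern H (t i - t j)))"
    using H by (intro sum_norm_le) (simp add: norm_mult kern_def mult_ac)
  also have "\<dots> = real H * (\<Sum>i\<in>I. \<Sum>j\<in>I. cmod (c i) * cmod (c j) * kern H (t i - t j))"
    by (simp add: sum_distrib_left mult_ac)
  finally show ?thesis using H by (simp add: g_def)
qed

text \<open>By the telescoping bound \<open>1/k\<^sup>2 \<le> 1/(k - 1) - 1/k\<close>.\<close>
lemma sum_inverse_squares_le: "(\<Sum>k=1..K. 1 / (real k)\<^sup>2) \<le> 2"
proof -
  have "(\<Sum>k=1..Suc K. 1 / (real k)\<^sup>2) \<le> 2 - 1 / real (Suc K)" for K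
  proof (induction K)
    case (Suc K)
    have "1 / (real (Suc (Suc K)))\<^sup>2 \<le> 1 / (real (Suc K) * real (Suc (Suc K)))"
      unfolding power2_eq_square by (intro divide_left_mono mult_right_mono mult_pos_pos) auto
    also have "\<dots> = 1 / real (Suc K) - 1 / real (Suc (Suc K))"
      by (simp add: field_simps)
    finally have "1 / (real (Suc (Suc K)))\<^sup>2 \<le> 1 / real (Suc K) - 1 / real (Suc (Suc K))" .
    with Suc show ?case by simp
  qed simp
  note * = this
  show ?thesis
  proof (cases K)
    case (Suc L)
    have "0 \<le> 1 / real (Suc L)" by simp
    with *[of L] show ?thesis unfolding Suc by linarith
  qed simp
qed

text \<open>
  Cut the circle into cells of length \<open>1/H\<close>, starting from \<open>0\<close> in both directions. Two points in
  one cell are closer than \<open>1/H\<close>, so spaced points are determined by the number of their cell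
  and the side of \<open>0\<close> on which it lies. The following sums are then dominated by twice a sum over
  cell numbers.
\<close>
lemma inj_on_cell_sign:
  fixes f :: "'i \<Rightarrow> real"
  assumes H: "H > 0"
    and spaced: "\<And>i j. i \<in> I \<Longrightarrow> j \<in> I \<Longrightarrow> i \<noteq> j \<Longrightarrow> 1 / real H \<le> dist_int (f i - f j)"
  shows "inj_on (\<lambda>i. (nat \<lfloor>real H * dist_int (f i)\<rfloor>, f i \<ge> of_int (round (f i)))) I"
proof (rule inj_onI, rule ccontr)
  fix i j assume ij: "i \<in> I" "j \<in> I" "i \<noteq> j"
    and eq: "(nat \<lfloor>real H * dist_int (f i)\<rfloor>, f i \<ge> of_int (round (f i)))
      = (nat \<lfloor>real H * dist_int (f j)\<rfloor>, f j \<ge> of_int (round (f j)))"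
  have "\<lfloor>real H * dist_int (f i)\<rfloor> = \<lfloor>real H * dist_int (f j)\<rfloor>"
    using eq dist_int_nonneg[of "f i"] dist_int_nonneg[of "f j"] by (simp add: nat_eq_iff2)
  then have "\<bar>real H * dist_int (f i) - real H * dist_int (f j)\<bar> < 1" by linarith
  then have "real H * \<bar>dist_int (f i) - dist_int (f j)\<bar> < 1"
    by (simp add: abs_mult flip: right_diff_distrib)
  then have lt: "\<bar>dist_int (f i) - dist_int (f j)\<bar> < 1 / real H"
    using H by (simp add: field_simps)
  have "dist_int (f i - f j) \<le> \<bar>f i - f j - of_int (round (f i) - round (f j))\<bar>"
    by (rule dist_int_le)
  also have "\<dots> = \<bar>dist_int (f i) - dist_int (f j)\<bar>"
    using eq unfolding dist_int_eq_round by auto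
  finally show False using lt spaced[OF ij] by linarith
qed

lemma sum_kern_away_le:
  fixes f :: "'i \<Rightarrow> real"
  assumes I: "finite I" and H: "H > 0"
    and spaced: "\<And>i j. i \<in> I \<Longrightarrow> j \<in> I \<Longrightarrow> i \<noteq> j \<Longrightarrow> 1 / real H \<le> dist_int (f i - f j)"
    and away: "\<And>i. i \<in> I \<Longrightarrow> 1 / real H \<le> dist_int (f i)"
  shows "(\<Sum>i\<in>I. kern H (f i)) \<le> real H"
proof -
  define k where "k i = nat \<lfloor>real H * dist_int (f i)\<rfloor>" for i
  define h where "h i = (k i, f i \<ge> of_int (round (f i)))" for i
  have inj: "inj_on h I"
    unfolding h_def k_def by (rule inj_on_cell_sign[OF H spaced])
  have k1: "k i \<ge> 1" if "i \<in> I" for i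
  proof -
    have "1 \<le> real H * dist_int (f i)" using away[OF that] H by (simp add: field_simps)
    then show ?thesis by (simp add: k_def le_nat_iff)
  qed
  have kern: "kern H (f i) \<le> real H / 4 * (1 / (real (k i))\<^sup>2)" if "i \<in> I" for i
  proof -
    have "real (k i) \<le> real H * dist_int (f i)"
      by (simp add: k_def dist_int_nonneg)
    then have "(real (k i))\<^sup>2 \<le> (real H)\<^sup>2 * (dist_int (f i))\<^sup>2"
      by (metis of_nat_0_le_iff power_mono power_mult_distrib)
    then have "(real (k i))\<^sup>2 * (4 * kern H (f i)) \<le> (real H)\<^sup>2 * (dist_int (f i))\<^sup>2 * (4 * kern H (f i))"
      by (intro mult_right_mono mult_nonneg_nonneg kern_nonneg) simp_all
    also have "\<dots> = real H * (4 * real H * (dist_int (f i))\<^sup>2 * kern H (f i))"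
      by (simp add: power2_eq_square)
    also have "\<dots> \<le> real H * 1"
      by (intro mult_left_mono kern_dist_int[OF H]) simp
    finally show ?thesis using k1[OF that] by (simp add: field_simps)
  qed
  define K where "K = Max (insert 0 (k ` I))"
  have kK: "k i \<le> K" if "i \<in> I" for i
    unfolding K_def using that I by (intro Max_ge) auto
  have "(\<Sum>i\<in>I. kern H (f i)) \<le> (\<Sum>i\<in>I. real H / 4 * (1 / (real (k i))\<^sup>2))"
    by (intro sum_mono kern)
  also have "\<dots> = (\<Sum>q\<in>h ` I. real H / 4 * (1 / (real (fst q))\<^sup>2))"
    by (subst sum.reindex[OF inj]) (simp add: h_def)
  also have "\<dots> \<le> (\<Sum>q\<in>{1..K} \<times> (UNIV :: bool set). real H / 4 * (1 / (real (fst q))\<^sup>2))"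
    by (rule sum_mono2) (use k1 kK in \<open>auto simp: h_def\<close>)
  also have "\<dots> = real H / 2 * (\<Sum>k=1..K. 1 / (real k)\<^sup>2)"
    by (simp add: sum.cartesian_product' UNIV_bool sum_distrib_left mult_ac flip: sum.distrib)
  also have "\<dots> \<le> real H / 2 * 2"
    by (intro mult_left_mono sum_inverse_squares_le) simp
  finally show ?thesis by simp
qed

text \<open>At most two points lie in the two cells adjacent to \<open>0\<close>, where the trivial bound \<open>2 H\<close> is used.\<close>
lemma sum_kern_le:
  fixes f :: "'i \<Rightarrow> real"
  assumes I: "finite I" and H: "H > 0"
    and spaced: "\<And>i j. i \<in> I \<Longrightarrow> j \<in> I \<Longrightarrow> i \<noteq> j \<Longrightarrow> 1 / real H \<le> dist_int (f i - f j)"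
  shows "(\<Sum>i\<in>I. kern H (f i)) \<le> 5 * real H"
proof -
  define J where "J = {i \<in> I. dist_int (f i) < 1 / real H}"
  define h where "h i = (nat \<lfloor>real H * dist_int (f i)\<rfloor>, f i \<ge> of_int (round (f i)))" for i
  have "inj_on h J"
    unfolding h_def by (rule inj_on_cell_sign[OF H]) (use spaced in \<open>auto simp: J_def\<close>)
  moreover have "h ` J \<subseteq> {0} \<times> UNIV"
  proof
    fix q assume "q \<in> h ` J"
    then obtain i where i: "i \<in> J" "q = h i" by blast
    have "real H * dist_int (f i) < 1" using i(1) H by (simp add: J_def field_simps)
    then have "\<lfloor>real H * dist_int (f i)\<rfloor> < 1" by simp
    with i(2) show "q \<in> {0} \<times> UNIV" by (simp add: h_def)
  qed
  ultimately have "card J \<le> card ({0::nat} \<times> (UNIV :: bool set))"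
    by (intro card_inj_on_le) auto
  then have card: "card J \<le> 2" by (simp add: card_cartesian_product)
  have "(\<Sum>i\<in>J. kern H (f i)) \<le> real (card J) * (2 * real H)"
    using kern_le[OF H] by (intro sum_bounded_above) auto
  also have "\<dots> \<le> 2 * (2 * real H)"
    using card by (intro mult_right_mono) auto
  finally have "(\<Sum>i\<in>J. kern H (f i)) \<le> 4 * real H" by simp
  moreover have "(\<Sum>i\<in>I - J. kern H (f i)) \<le> real H"
    using I H spaced by (intro sum_kern_away_le) (auto simp: J_def)
  moreover have "(\<Sum>i\<in>I. kern H (f i)) = (\<Sum>i\<in>I - J. kern H (f i)) + (\<Sum>i\<in>J. kern H (f i))"
    using I by (intro sum.subset_diff) (auto simp: J_def)
  ultimately show ?thesis by simp
qed

text \<open>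
  When one of the points is \<open>0\<close> itself, all others are at distance at least \<open>1/H\<close> from it, and the
  constant \<open>5\<close> of the preceding lemma improves to \<open>3\<close>.
\<close>
lemma sum_kern_diff_le:
  fixes f :: "'i \<Rightarrow> real"
  assumes I: "finite I" and H: "H > 0" and i: "i \<in> I"
    and spaced: "\<And>i j. i \<in> I \<Longrightarrow> j \<in> I \<Longrightarrow> i \<noteq> j \<Longrightarrow> 1 / real H \<le> dist_int (f i - f j)"
  shows "(\<Sum>j\<in>I. kern H (f i - f j)) \<le> 3 * real H"
proof -
  have "(\<Sum>j\<in>I - {i}. kern H (f j - f i)) \<le> real H"
    using I H spaced i by (intro sum_kern_away_le) auto
  moreover have "kern H (f i - f j) = kern H (f j - f i)" for j
    using kern_minus[of H "f j - f i"] by simp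
  moreover have "(\<Sum>j\<in>I. kern H (f i - f j))
      = kern H (f i - f i) + (\<Sum>j\<in>I - {i}. kern H (f i - f j))"
    by (rule sum.remove[OF I i])
  moreover have "kern H (f i - f i) \<le> 2 * real H" by (rule kern_le[OF H])
  ultimately show ?thesis by simp
qed

text \<open>The test of Schur for a symmetric nonnegative kernel, by \<open>2 b\<^sub>i b\<^sub>j \<le> b\<^sub>i\<^sup>2 + b\<^sub>j\<^sup>2\<close>.\<close>
lemma schur_bound:
  fixes b :: "'i \<Rightarrow> real" and w :: "'i \<Rightarrow> 'i \<Rightarrow> real"
  assumes w: "\<And>i j. i \<in> I \<Longrightarrow> j \<in> I \<Longrightarrow> w i j \<ge> 0"
    and sym: "\<And>i j. w i j = w j i"
    and row: "\<And>i. i \<in> I \<Longrightarrow> (\<Sum>j\<in>I. w i j) \<le> C"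
  shows "(\<Sum>i\<in>I. \<Sum>j\<in>I. b i * b j * w i j) \<le> C * (\<Sum>i\<in>I. (b i)\<^sup>2)"
proof -
  have "(\<Sum>i\<in>I. \<Sum>j\<in>I. b i * b j * w i j)
      \<le> (\<Sum>i\<in>I. \<Sum>j\<in>I. ((b i)\<^sup>2 * w i j + (b j)\<^sup>2 * w i j) / 2)"
  proof (intro sum_mono)
    fix i j assume "i \<in> I" "j \<in> I"
    moreover have "b i * b j \<le> ((b i)\<^sup>2 + (b j)\<^sup>2) / 2"
      using sum_squares_bound[of "b i" "b j"] by simp
    ultimately have "b i * b j * w i j \<le> ((b i)\<^sup>2 + (b j)\<^sup>2) / 2 * w i j"
      using w by (intro mult_right_mono) auto
    then show "b i * b j * w i j \<le> ((b i)\<^sup>2 * w i j + (b j)\<^sup>2 * w i j) / 2"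
      by (simp add: algebra_simps add_divide_distrib)
  qed
  also have "\<dots> = ((\<Sum>i\<in>I. \<Sum>j\<in>I. (b i)\<^sup>2 * w i j) + (\<Sum>i\<in>I. \<Sum>j\<in>I. (b j)\<^sup>2 * w i j)) / 2"
    by (simp add: sum.distrib flip: sum_divide_distrib)
  also have "(\<Sum>i\<in>I. \<Sum>j\<in>I. (b j)\<^sup>2 * w i j) = (\<Sum>i\<in>I. \<Sum>j\<in>I. (b i)\<^sup>2 * w i j)"
    by (subst sum.swap) (simp add: sym)
  also have "((\<Sum>i\<in>I. \<Sum>j\<in>I. (b i)\<^sup>2 * w i j) + (\<Sum>i\<in>I. \<Sum>j\<in>I. (b i)\<^sup>2 * w i j)) / 2
      = (\<Sum>i\<in>I. \<Sum>j\<in>I. (b i)\<^sup>2 * w i j)"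
    by simp
  also have "\<dots> = (\<Sum>i\<in>I. (b i)\<^sup>2 * (\<Sum>j\<in>I. w i j))"
    unfolding sum_distrib_left ..
  also have "\<dots> \<le> (\<Sum>i\<in>I. (b i)\<^sup>2 * C)"
    by (intro sum_mono mult_left_mono row) auto
  finally show ?thesis by (simp add: sum_distrib_left mult_ac)
qed

text \<open>The dual large sieve: the rows of the kernel at well spaced points have sums at most \<open>3 H\<close>.\<close>
lemma large_sieve:
  fixes b :: "'i \<Rightarrow> complex" and \<xi> :: "'i \<Rightarrow> real" and m :: int
  assumes I: "finite I" and H: "H > 0"
    and spaced: "\<And>i j. i \<in> I \<Longrightarrow> j \<in> I \<Longrightarrow> i \<noteq> j \<Longrightarrow> 1 / real H \<le> dist_int (\<xi> i - \<xi> j)"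
  shows "(\<Sum>n\<le>H. (cmod (\<Sum>i\<in>I. b i * ee (of_int (m + int n) * \<xi> i)))\<^sup>2)
    \<le> 3 * real H * (\<Sum>i\<in>I. (cmod (b i))\<^sup>2)"
proof -
  have "kern H (\<xi> i - \<xi> j) = kern H (\<xi> j - \<xi> i)" for i j
    using kern_minus[of H "\<xi> j - \<xi> i"] by simp
  then have "(\<Sum>i\<in>I. \<Sum>j\<in>I. cmod (b i) * cmod (b j) * kern H (\<xi> i - \<xi> j))
      \<le> 3 * real H * (\<Sum>i\<in>I. (cmod (b i))\<^sup>2)"
    by (intro schur_bound sum_kern_diff_le[OF I H]) (auto simp: kern_nonneg spaced)
  then show ?thesis
    by (rule order_trans[OF mean_square_le_kern[OF I H]])
qed

section \<open>The estimates of Chebyshev and Mertens\<close>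

lemma prod_primes_dvd:
  fixes m :: nat
  assumes "finite P" "\<And>p. p \<in> P \<Longrightarrow> prime p" "\<And>p. p \<in> P \<Longrightarrow> p dvd m"
  shows "\<Prod>P dvd m"
  using assms
proof (induction P rule: finite_induct)
  case (insert p P)
  have "coprime p (\<Prod>P)"
    using insert by (intro prod_coprime_right) (metis insert_iff primes_coprime)
  then show ?case using insert by (simp add: divides_mult)
qed simp

definition primes_upto :: "nat \<Rightarrow> nat set"
  where "primes_upto n = {p. prime p \<and> p \<le> n}"

lemma finite_primes_upto [simp]: "finite (primes_upto n)"
  by (rule finite_subset[of _ "{..n}"]) (auto simp: primes_upto_def)

lemma prime_primes_upto: "p \<in> primes_upto n \<Longrightarrow> prime p"
  by (simp add: primes_upto_def)

lemma binomial_odd_le: "(2 * m + 1) choose m \<le> 4 ^ m"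
proof -
  have "2 * ((2 * m + 1) choose m) = (\<Sum>k\<in>{m, Suc m}. (2 * m + 1) choose k)"
    using binomial_symmetric[of m "2 * m + 1"] by simp
  also have "\<dots> \<le> (\<Sum>k\<le>2 * m + 1. (2 * m + 1) choose k)"
    by (intro sum_mono2) auto
  also have "\<dots> = 2 * 4 ^ m"
    unfolding choose_row_sum by (simp add: power_mult)
  finally show ?thesis by simp
qed

text \<open>
  The argument of Erdos: the primes between \<open>m + 2\<close> and \<open>2 m + 1\<close> all divide
  \<open>(2 m + 1) choose m\<close>, which is at most \<open>4 ^ m\<close>.
\<close>
lemma primorial_le: "\<Prod>(primes_upto n) \<le> 4 ^ n"
proof (induction n rule: less_induct)
  case (less n)
  have "n \<le> 2 \<or> (\<exists>m. n > 2 \<and> n = 2 * m) \<or> (\<exists>m. n = 2 * m + 1 \<and> m > 0)"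
    by presburger
  then consider "n \<le> 2" | m where "n > 2" "n = 2 * m" | m where "n = 2 * m + 1" "m > 0"
    by blast
  then show ?case
  proof cases
    case 1
    have "primes_upto 0 = {}" "primes_upto 1 = {}" "primes_upto 2 = {2}"
      by (auto simp: primes_upto_def dest: prime_ge_2_nat intro: antisym)
    moreover have "n = 0 \<or> n = 1 \<or> n = 2" using 1 by auto
    ultimately show ?thesis by auto
  next
    case 2
    have "\<not> prime n" using 2 prime_odd_nat[of n] by auto
    then have "primes_upto n = primes_upto (n - 1)"
    proof -
      have "p \<le> n - 1" if "prime p" "p \<le> n" for p
        using that \<open>\<not> prime n\<close> by (cases "p = n") auto
      then show ?thesis by (auto simp: primes_upto_def)
    qed
    moreover have "\<Prod>(primes_upto (n - 1)) \<le> 4 ^ (n - 1)" using 2 by (intro less.IH) auto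
    moreover have "(4::nat) ^ (n - 1) \<le> 4 ^ n" by (intro power_increasing) auto
    ultimately show ?thesis by (metis order_trans)
  next
    case 3
    define Q where "Q = primes_upto n - primes_upto (m + 1)"
    have "p dvd (2 * m + 1) choose m" if "p \<in> Q" for p
    proof -
      have p: "prime p" "m + 1 < p" "p \<le> 2 * m + 1"
        using that 3 by (auto simp: Q_def primes_upto_def)
      have "p dvd fact (2 * m + 1)" using p by (subst prime_dvd_fact_iff)
      also have "(fact (2 * m + 1) :: nat) = fact m * fact (m + 1) * ((2 * m + 1) choose m)"
        using binomial_fact_lemma[of m "2 * m + 1"] by simp
      finally show ?thesis
        using p prime_dvd_fact_iff[of p m] prime_dvd_fact_iff[of p "m + 1"]
        by (simp only: prime_dvd_mult_iff) auto
    qed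
    then have "\<Prod>Q dvd (2 * m + 1) choose m"
      by (intro prod_primes_dvd) (auto simp: Q_def primes_upto_def)
    then have "\<Prod>Q \<le> 4 ^ m"
      by (intro order_trans[OF dvd_imp_le binomial_odd_le]) auto
    moreover have "\<Prod>(primes_upto (m + 1)) \<le> 4 ^ (m + 1)" using 3 by (intro less.IH) auto
    moreover have "\<Prod>(primes_upto n) = \<Prod>Q * \<Prod>(primes_upto (m + 1))"
      unfolding Q_def using 3 by (intro prod.subset_diff) (auto simp: primes_upto_def)
    ultimately have "\<Prod>(primes_upto n) \<le> 4 ^ m * 4 ^ (m + 1)" by (simp only: mult_mono)
    also have "\<dots> = 4 ^ n" by (simp add: 3 mult_2 flip: power_add)
    finally show ?thesis .
  qed
qed

lemma sum_ln_primes_le: "(\<Sum>p\<in>primes_upto n. ln (real p)) \<le> real n * ln 4"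
proof -
  have pos: "\<And>p. p \<in> primes_upto n \<Longrightarrow> p > 0" by (simp add: primes_upto_def prime_gt_0_nat)
  have "(\<Sum>p\<in>primes_upto n. ln (real p)) = ln (\<Prod>p\<in>primes_upto n. real p)"
    using pos by (intro ln_prod[symmetric]) auto
  also have "(\<Prod>p\<in>primes_upto n. real p) = real (\<Prod>(primes_upto n))" by simp
  also have "ln \<dots> \<le> ln (real (4 ^ n))"
  proof -
    have "\<Prod>(primes_upto n) > 0" using pos by (intro prod_pos) auto
    then show ?thesis using primorial_le[of n] by (subst ln_le_cancel_iff) (auto simp del: of_nat_prod)
  qed
  also have "\<dots> = real n * ln 4" by (simp add: ln_realpow)
  finally show ?thesis .
qed

lemma sum_ln_prime_divisors_le:
  assumes "m > 0"
  shows "(\<Sum>p\<in>prime_factors m. ln (real p)) \<le> ln (real m)"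
proof -
  have pos: "\<And>p. p \<in> prime_factors m \<Longrightarrow> p > 0" by (simp add: prime_factors_gt_0_nat)
  have "(\<Sum>p\<in>prime_factors m. ln (real p)) = ln (real (\<Prod>(prime_factors m)))"
    unfolding of_nat_prod using pos by (intro ln_prod[symmetric]) auto
  also have "\<dots> \<le> ln (real m)"
  proof -
    have "\<Prod>(prime_factors m) dvd m" by (intro prod_primes_dvd) auto
    then have "\<Prod>(prime_factors m) \<le> m" using assms by (rule dvd_imp_le)
    moreover have "\<Prod>(prime_factors m) > 0" using pos by (intro prod_pos) auto
    ultimately show ?thesis using assms by (subst ln_le_cancel_iff) (auto simp del: of_nat_prod)
  qed
  finally show ?thesis .
qed

lemma card_multiples: 
  assumes "p > 0"
  shows "card {m\<in>{1..n}. p dvd m} = n div (p::nat)"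
proof -
  have "{m\<in>{1..n}. p dvd m} = (\<lambda>k. p * k) ` {1..n div p}"
    using assms by (auto simp: less_eq_div_iff_mult_less_eq mult.commute elim!: dvdE)
  moreover have "inj_on (\<lambda>k. p * k) {1..n div p}" using assms by (auto intro: inj_onI)
  ultimately show ?thesis by (simp add: card_image)
qed

text \<open>
  Summing \<open>\<Sum>p dvd m. ln p \<le> ln m\<close> over \<open>m \<le> n\<close> gives \<open>\<Sum>p. (n div p) ln p \<le> n ln n\<close>. Replacing
  \<open>n div p\<close> by \<open>n/p\<close> costs at most the sum of \<open>ln p\<close> over the primes up to \<open>n\<close>.
\<close>
lemma mertens_sum_le:
  assumes "n > 0"
  shows "(\<Sum>p\<in>primes_upto n. ln (real p) / real p) \<le> ln (real n) + ln 4"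
proof -
  have "(\<Sum>p\<in>primes_upto n. ln (real p) * real (n div p))
      = (\<Sum>p\<in>primes_upto n. \<Sum>m\<in>{m\<in>{1..n}. p dvd m}. ln (real p))"
  proof (intro sum.cong refl)
    fix p assume "p \<in> primes_upto n"
    then have "p > 0" by (simp add: primes_upto_def prime_gt_0_nat)
    then show "ln (real p) * real (n div p) = (\<Sum>m\<in>{m\<in>{1..n}. p dvd m}. ln (real p))"
      by (simp only: sum_constant card_multiples mult.commute)
  qed
  also have "\<dots> = (\<Sum>m=1..n. \<Sum>p\<in>{p \<in> primes_upto n. p dvd m}. ln (real p))"
    by (rule sum.swap_restrict) auto
  also have "\<dots> \<le> (\<Sum>m=1..n. ln (real m))"
  proof (intro sum_mono)
    fix m assume m: "m \<in> {1..n}"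
    then have "{p \<in> primes_upto n. p dvd m} = prime_factors m"
      by (auto simp: primes_upto_def prime_factors_dvd dest: dvd_imp_le)
    then show "(\<Sum>p\<in>{p \<in> primes_upto n. p dvd m}. ln (real p)) \<le> ln (real m)"
      using sum_ln_prime_divisors_le[of m] m by simp
  qed
  also have "\<dots> \<le> (\<Sum>m=1..n. ln (real n))" by (intro sum_mono) auto
  finally have 1: "(\<Sum>p\<in>primes_upto n. ln (real p) * real (n div p)) \<le> real n * ln (real n)"
    by simp
  have "real n * (\<Sum>p\<in>primes_upto n. ln (real p) / real p)
      \<le> (\<Sum>p\<in>primes_upto n. ln (real p) * real (n div p) + ln (real p))"
    unfolding sum_distrib_left
  proof (intro sum_mono)
    fix p assume "p \<in> primes_upto n"
    then have p: "p \<ge> 1" using prime_ge_1_nat[of p] by (simp add: primes_upto_def)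
    have "real n / real p \<le> real (n div p) + 1"
    proof -
      have "n < p + p * (n div p)" using p by (intro dividend_less_times_div) auto
      then have "real n \<le> real p * (real (n div p) + 1)"
        by (simp add: algebra_simps del: of_nat_div flip: of_nat_mult of_nat_add)
      then show ?thesis using p by (simp add: field_simps del: of_nat_div)
    qed
    then have "ln (real p) * (real n / real p) \<le> ln (real p) * (real (n div p) + 1)"
      using p by (intro mult_left_mono) auto
    then show "real n * (ln (real p) / real p) \<le> ln (real p) * real (n div p) + ln (real p)"
      by (simp add: algebra_simps del: of_nat_div)
  qed
  also have "\<dots> \<le> real n * ln (real n) + real n * ln 4"
    unfolding sum.distrib using 1 sum_ln_primes_le[of n] by linarith
  also have "\<dots> = real n * (ln (real n) + ln 4)" by (simp add: algebra_simps)
  finally show ?thesis using assms by simp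
qed

text \<open>
  The terms are compared with the differences of \<open>(ln m + 2)/m\<close>; this expression is suggested by the
  primitive \<open>- (ln t + 1)/t\<close> of \<open>ln t/t\<^sup>2\<close>, and the larger constant absorbs the shift from \<open>m\<^sup>2\<close> to
  \<open>m (m - 1)\<close>.
\<close>
lemma sum_ln_over_pronic_le:
  "(\<Sum>m=2..n. ln (real m) / (real m * (real m - 1))) \<le> 2"
proof (cases "n \<ge> 1")
  case True
  then have "(\<Sum>m=2..n. ln (real m) / (real m * (real m - 1))) \<le> 2 - (ln (real n) + 2) / real n"
  proof (induction n rule: dec_induct)
    case (step n)
    have n: "real n \<ge> 1" using step.hyps by simp
    have "ln (real n + 1) - ln (real n) = ln ((real n + 1) / real n)"
      using n by (simp add: ln_div)
    also have "(real n + 1) / real n = 1 + 1 / real n"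
      using n by (simp add: field_simps)
    also have "ln (1 + 1 / real n) \<le> 1 / real n" by (rule ln_add_one_self_le_self) simp
    finally have l: "ln (real n + 1) \<le> ln (real n) + 1 / real n" by simp
    have "(real n + 1) * ln (real n + 1) \<le> (real n + 1) * (ln (real n) + 1 / real n)"
      using l n by (intro mult_left_mono) auto
    also have "\<dots> \<le> (real n + 1) * ln (real n) + 2"
      using n by (simp add: field_simps)
    finally have "ln (real n + 1) \<le> (real n + 1) * (ln (real n) + 2) - real n * (ln (real n + 1) + 2)"
      by (simp add: algebra_simps)
    then have "ln (real n + 1) / ((real n + 1) * real n)
        \<le> ((real n + 1) * (ln (real n) + 2) - real n * (ln (real n + 1) + 2)) / ((real n + 1) * real n)"
      using n by (intro divide_right_mono) auto
    also have "\<dots> = (ln (real n) + 2) / real n - (ln (real n + 1) + 2) / (real n + 1)"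
      using n by (simp add: diff_divide_distrib)
    finally show ?case using step by (simp add: add.commute)
  qed simp
  moreover have "(ln (real n) + 2) / real n \<ge> 0" using True by simp
  ultimately show ?thesis by linarith
qed simp

lemma mertens_sum_pred_le:
  assumes "n > 0"
  shows "(\<Sum>p\<in>primes_upto n. ln (real p) / (real p - 1)) \<le> ln (real n) + ln 4 + 2"
proof -
  have "(\<Sum>p\<in>primes_upto n. ln (real p) / (real p - 1))
      = (\<Sum>p\<in>primes_upto n. ln (real p) / real p) + (\<Sum>p\<in>primes_upto n. ln (real p) / (real p * (real p - 1)))"
    unfolding sum.distrib[symmetric]
  proof (intro sum.cong refl)
    fix p assume "p \<in> primes_upto n"
    then have "real p > 1" using prime_gt_1_nat[of p] by (simp add: primes_upto_def)
    then show "ln (real p) / (real p - 1) = ln (real p) / real p + ln (real p) / (real p * (real p - 1))"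
      by (simp add: field_simps)
  qed
  moreover have "(\<Sum>p\<in>primes_upto n. ln (real p) / (real p * (real p - 1)))
      \<le> (\<Sum>m=2..n. ln (real m) / (real m * (real m - 1)))"
    by (intro sum_mono2) (auto simp: primes_upto_def prime_ge_2_nat)
  ultimately show ?thesis
    using mertens_sum_le[OF assms] sum_ln_over_pronic_le[of n] by linarith
qed

text \<open>Comparison with the telescoping differences of \<open>- n\<^bsup>-\<sigma>\<^esup>/\<sigma>\<close>.\<close>
lemma sum_powr_le:
  assumes \<sigma>: "\<sigma> > 0"
  shows "(\<Sum>n=1..K. real n powr (- 1 - \<sigma>)) \<le> 1 + 1 / \<sigma>"
proof (cases "K \<ge> 1")
  case True
  then have "(\<Sum>n=1..K. real n powr (- 1 - \<sigma>)) \<le> 1 + 1 / \<sigma> - real K powr (- \<sigma>) / \<sigma>"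
  proof (induction K rule: dec_induct)
    case base
    then show ?case by simp
  next
    case (step K)
    define x where "x = real K + 1"
    have x: "x > 1" "real K = x * (1 - 1 / x)" using step.hyps by (auto simp: x_def field_simps)
    have "ln (1 - 1 / x) \<le> - (1 / x)"
      using ln_le_minus_one[of "1 - 1 / x"] x by simp
    then have "\<sigma> * ln (1 - 1 / x) \<le> \<sigma> * - (1 / x)"
      using \<sigma> by (intro mult_left_mono) auto
    then have "1 + \<sigma> / x \<le> 1 + (- \<sigma> * ln (1 - 1 / x))" by simp
    also have "\<dots> \<le> (1 - 1 / x) powr (- \<sigma>)"
      using exp_ge_add_one_self[of "- \<sigma> * ln (1 - 1 / x)"] x by (simp add: powr_def)
    finally have "x powr (- \<sigma>) * (1 + \<sigma> / x) \<le> x powr (- \<sigma>) * (1 - 1 / x) powr (- \<sigma>)"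
      by (intro mult_left_mono) auto
    also have "\<dots> = real K powr (- \<sigma>)" using x by (simp add: powr_mult)
    finally have "x powr (- \<sigma>) * \<sigma> / x \<le> real K powr (- \<sigma>) - x powr (- \<sigma>)"
      by (simp add: algebra_simps)
    moreover have "x powr (- 1 - \<sigma>) = x powr (- \<sigma>) / x"
    proof -
      have "- 1 - \<sigma> = - \<sigma> - 1" by simp
      then show ?thesis using x by (simp only: powr_diff powr_one)
    qed
    ultimately have "x powr (- 1 - \<sigma>) * \<sigma> \<le> real K powr (- \<sigma>) - x powr (- \<sigma>)" by simp
    then have "x powr (- 1 - \<sigma>) \<le> real K powr (- \<sigma>) / \<sigma> - x powr (- \<sigma>) / \<sigma>"
      using \<sigma> by (simp add: field_simps)
    then show ?case using step by (simp add: x_def add.commute)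
  qed
  moreover have "real K powr (- \<sigma>) / \<sigma> \<ge> 0" using \<sigma> by simp
  ultimately show ?thesis by linarith
qed (use \<sigma> in simp)

lemma zeta_bounds:
  assumes \<sigma>: "\<sigma> > 0"
  shows "(\<lambda>n. real n powr (- 1 - \<sigma>)) summable_on {1..}"
    and "infsum (\<lambda>n. real n powr (- 1 - \<sigma>)) {1..} \<le> 1 + 1 / \<sigma>"
proof -
  have fin: "sum (\<lambda>n. real n powr (- 1 - \<sigma>)) F \<le> 1 + 1 / \<sigma>" if "finite F" "F \<subseteq> {1..}" for F
  proof -
    have "sum (\<lambda>n. real n powr (- 1 - \<sigma>)) F \<le> (\<Sum>n=1..Max (insert 0 F). real n powr (- 1 - \<sigma>))"
      using that by (intro sum_mono2) auto
    with sum_powr_le[OF \<sigma>] show ?thesis by (rule order_trans[rotated])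
  qed
  show *: "(\<lambda>n. real n powr (- 1 - \<sigma>)) summable_on {1..}"
    by (rule nonneg_bdd_above_summable_on) (auto intro!: bdd_aboveI[of _ "1 + 1 / \<sigma>"] fin)
  show "infsum (\<lambda>n. real n powr (- 1 - \<sigma>)) {1..} \<le> 1 + 1 / \<sigma>"
    by (rule infsum_le_finite_sums[OF * fin])
qed

text \<open>
  Removing from \<open>\<zeta>(1 + \<sigma>)\<close> the multiples of a prime \<open>q\<close> multiplies it by \<open>1 - q\<^bsup>-1-\<sigma>\<^esup>\<close>. When
  this is done for all primes of \<open>P\<close>, the term \<open>n = 1\<close> survives.
\<close>
lemma euler_product_ge_1:
  assumes \<sigma>: "\<sigma> > 0" and "finite P" "\<And>p. p \<in> P \<Longrightarrow> prime p"
  shows "1 \<le> (\<Prod>p\<in>P. 1 - real p powr (- 1 - \<sigma>)) * infsum (\<lambda>n. real n powr (- 1 - \<sigma>)) {1..}"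
proof -
  define C where "C P = {n\<in>{1..}. \<forall>p\<in>P. \<not> p dvd n}" for P :: "nat set"
  define f where "f n = real n powr (- 1 - \<sigma>)" for n :: nat
  have summ: "f summable_on C P" for P
    unfolding f_def by (rule summable_on_subset_banach[OF zeta_bounds(1)[OF \<sigma>]]) (auto simp: C_def)
  have "infsum f (C P) = (\<Prod>p\<in>P. 1 - f p) * infsum f {1..}"
    using assms(2,3)
  proof (induction P rule: finite_induct)
    case empty
    have "C {} = {1..}" by (auto simp: C_def)
    then show ?case by simp
  next
    case (insert q P)
    have q: "prime q" "q > 0" using insert.prems by (auto simp: prime_gt_0_nat)
    have eq: "C P = C (insert q P) \<union> (\<lambda>n. q * n) ` C P"
    proof (intro equalityI subsetI)
      fix n assume n: "n \<in> C P"
      show "n \<in> C (insert q P) \<union> (\<lambda>n. q * n) ` C P"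
      proof (cases "q dvd n")
        case True
        then obtain m where "n = q * m" by blast
        moreover from this have "m \<in> C P" using n by (auto simp: C_def)
        ultimately show ?thesis by blast
      qed (use n in \<open>simp add: C_def\<close>)
    next
      fix n assume "n \<in> C (insert q P) \<union> (\<lambda>n. q * n) ` C P"
      then show "n \<in> C P"
      proof
        assume "n \<in> (\<lambda>n. q * n) ` C P"
        then obtain m where m: "n = q * m" "m \<in> C P" by blast
        have "\<not> p dvd q" if "p \<in> P" for p
          using that q insert.prems insert.hyps primes_dvd_imp_eq by (metis insertCI)
        then show ?thesis using m q insert.prems
          by (auto simp: C_def prime_dvd_mult_iff)
      qed (auto simp: C_def)
    qed
    have disj: "C (insert q P) \<inter> (\<lambda>n. q * n) ` C P = {}"
      by (auto simp: C_def)
    have "infsum f ((\<lambda>n. q * n) ` C P) = infsum (f \<circ> (\<lambda>n. q * n)) (C P)"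
      using q by (intro infsum_reindex) (auto intro: inj_onI)
    also have "f \<circ> (\<lambda>n. q * n) = (\<lambda>n. f q * f n)"
      by (auto simp: f_def powr_mult)
    also have "infsum (\<lambda>n. f q * f n) (C P) = f q * infsum f (C P)"
      by (rule infsum_cmult_right) (use summ in auto)
    finally have img: "infsum f ((\<lambda>n. q * n) ` C P) = f q * infsum f (C P)" .
    have "f summable_on (\<lambda>n. q * n) ` C P"
      by (rule summable_on_subset_banach[OF summ[of P]]) (use eq in blast)
    then have "infsum f (C P) = infsum f (C (insert q P)) + f q * infsum f (C P)"
      using infsum_Un_disjoint[OF summ[of "insert q P"] _ disj] eq img by simp
    then have "infsum f (C (insert q P)) = (1 - f q) * infsum f (C P)"
      by (simp add: algebra_simps)
    then show ?case using insert by simp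
  qed
  moreover have "1 \<le> infsum f (C P)"
  proof -
    have "sum f {1} \<le> infsum f (C P)"
      using assms(3)[of 1] by (intro finite_sum_le_infsum summ) (auto simp: C_def f_def)
    then show ?thesis by (simp add: f_def)
  qed
  ultimately show ?thesis unfolding f_def by simp
qed

text \<open>
  The exponent \<open>1\<close> is moved to \<open>1 + \<sigma>\<close>, where the Euler product is bounded by
  \<open>\<zeta>(1 + \<sigma>) \<le> 1 + 1/\<sigma>\<close>. Each factor changes by at most \<open>exp (\<sigma> ln p/(p - 1))\<close>. With \<open>\<sigma>\<close> the
  inverse of the bound for \<open>\<Sum>ln p/(p - 1)\<close> the total change is at most \<open>exp 1\<close>.
\<close>
lemma mertens_product_le:
  assumes "n > 0"
  shows "(\<Prod>p\<in>primes_upto n. real p / (real p - 1)) \<le> exp 1 * (ln (real n) + ln 4 + 3)"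
proof -
  define L where "L = ln (real n) + ln 4 + 2"
  define \<sigma> where "\<sigma> = 1 / L"
  have L: "L > 0" using assms by (simp add: L_def add_nonneg_pos)
  then have \<sigma>: "\<sigma> > 0" by (simp add: \<sigma>_def)
  define f where "f p = real p powr (- 1 - \<sigma>)" for p :: nat
  have p1: "real p > 1" if "p \<in> primes_upto n" for p
    using that prime_gt_1_nat[of p] by (simp add: primes_upto_def)
  have factor: "(1 - f p) * (real p / (real p - 1)) \<le> exp (\<sigma> * (ln (real p) / (real p - 1)))"
    if "p \<in> primes_upto n" for p
  proof -
    note p = p1[OF that]
    have "f p = real p powr (- \<sigma>) / real p"
    proof -
      have "- 1 - \<sigma> = - \<sigma> - 1" by simp
      then show ?thesis using p by (simp only: f_def powr_diff powr_one)
    qed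
    moreover have "real p powr (- \<sigma>) \<ge> 1 - \<sigma> * ln (real p)"
      using exp_ge_add_one_self[of "- \<sigma> * ln (real p)"] p by (simp add: powr_def)
    ultimately have "f p * real p \<ge> 1 - \<sigma> * ln (real p)" using p by simp
    then have "(1 - f p) * real p \<le> (real p - 1) + \<sigma> * ln (real p)" by (simp add: algebra_simps)
    then have "(1 - f p) * real p / (real p - 1) \<le> ((real p - 1) + \<sigma> * ln (real p)) / (real p - 1)"
      using p by (intro divide_right_mono) auto
    also have "\<dots> = 1 + \<sigma> * (ln (real p) / (real p - 1))"
      using p by (simp add: add_divide_distrib)
    also have "\<dots> \<le> exp (\<sigma> * (ln (real p) / (real p - 1)))" by (rule exp_ge_add_one_self)
    finally show ?thesis by simp
  qed
  have f1: "0 \<le> 1 - f p" if "p \<in> primes_upto n" for p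
    using p1[OF that] \<sigma> powr_mono[of "- 1 - \<sigma>" 0 "real p"] by (simp add: f_def)
  have Q: "0 \<le> (\<Prod>p\<in>primes_upto n. real p / (real p - 1))"
  proof (intro prod_nonneg ballI divide_nonneg_nonneg)
    fix p assume "p \<in> primes_upto n"
    then show "0 \<le> real p - 1" using p1[of p] by simp
  qed simp
  have "(\<Prod>p\<in>primes_upto n. real p / (real p - 1)) * 1
      \<le> (\<Prod>p\<in>primes_upto n. real p / (real p - 1)) * ((\<Prod>p\<in>primes_upto n. 1 - f p) * (1 + 1 / \<sigma>))"
  proof (rule mult_left_mono[OF _ Q])
    have "1 \<le> (\<Prod>p\<in>primes_upto n. 1 - f p) * infsum f {1..}"
      unfolding f_def by (rule euler_product_ge_1[OF \<sigma>]) (auto simp: prime_primes_upto)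
    also have "\<dots> \<le> (\<Prod>p\<in>primes_upto n. 1 - f p) * (1 + 1 / \<sigma>)"
      unfolding f_def
      by (intro mult_left_mono zeta_bounds(2)[OF \<sigma>] prod_nonneg) (use f1 in \<open>auto simp: f_def\<close>)
    finally show "1 \<le> (\<Prod>p\<in>primes_upto n. 1 - f p) * (1 + 1 / \<sigma>)" .
  qed
  also have "\<dots> = (\<Prod>p\<in>primes_upto n. (1 - f p) * (real p / (real p - 1))) * (1 + L)"
    unfolding prod.distrib \<sigma>_def by simp
  also have "\<dots> \<le> (\<Prod>p\<in>primes_upto n. exp (\<sigma> * (ln (real p) / (real p - 1)))) * (1 + L)"
  proof (intro mult_right_mono prod_mono conjI factor)
    fix p assume p: "p \<in> primes_upto n"
    show "0 \<le> (1 - f p) * (real p / (real p - 1))"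
      using f1[OF p] p1[OF p] by (intro mult_nonneg_nonneg divide_nonneg_nonneg) auto
  qed (use L in auto)
  also have "\<dots> = exp (\<sigma> * (\<Sum>p\<in>primes_upto n. ln (real p) / (real p - 1))) * (1 + L)"
    by (simp add: exp_sum sum_distrib_left)
  also have "\<dots> \<le> exp 1 * (1 + L)"
  proof (intro mult_right_mono)
    have "\<sigma> * (\<Sum>p\<in>primes_upto n. ln (real p) / (real p - 1)) \<le> \<sigma> * L"
      unfolding L_def using \<sigma> mertens_sum_pred_le[OF assms] by (intro mult_left_mono) auto
    also have "\<dots> = 1" using L by (simp add: \<sigma>_def)
    finally show "exp (\<sigma> * (\<Sum>p\<in>primes_upto n. ln (real p) / (real p - 1))) \<le> exp 1" by simp
  qed (use L in simp)
  finally show ?thesis by (simp add: L_def algebra_simps)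
qed

section \<open>Lower bound for the sieve sum\<close>

definition composed_upto :: "nat set \<Rightarrow> nat \<Rightarrow> nat set"
  where "composed_upto P Z = {n\<in>{1..Z}. prime_factors n \<subseteq> P}"

definition sieve_moduli :: "nat set \<Rightarrow> nat \<Rightarrow> nat set"
  where "sieve_moduli P Z = {r\<in>{1..Z}. squarefree r \<and> prime_factors r \<subseteq> P}"

text \<open>The quantity usually called \<open>G\<close> in the sieve of Selberg.\<close>
definition sieve_sum :: "nat set \<Rightarrow> nat \<Rightarrow> real"
  where "sieve_sum P Z = (\<Sum>r\<in>sieve_moduli P Z. 1 / real (totient r))"

lemma finite_composed_upto [simp]: "finite (composed_upto P Z)"
  by (simp add: composed_upto_def)

lemma finite_sieve_moduli [simp]: "finite (sieve_moduli P Z)"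
  by (simp add: sieve_moduli_def)

lemma prime_factors_prime_mult:
  fixes q n :: nat
  assumes "prime q" "n > 0"
  shows "prime_factors (q * n) = insert q (prime_factors n)"
  using assms by (subst prime_factors_product) (auto simp: prime_factorization_prime)

lemma mult_le_iff_le_div: "q > 0 \<Longrightarrow> q * n \<le> Z \<longleftrightarrow> n \<le> Z div (q::nat)"
  by (simp add: less_eq_div_iff_mult_less_eq mult.commute)

text \<open>
  The numbers divisible by \<open>q\<close> are \<open>q\<close> times numbers of the same kind up to \<open>Z div q\<close>. This recursion
  replaces the sum over all powers of \<open>q\<close>.
\<close>
lemma sum_inverse_insert:
  assumes q: "prime q" "q \<notin> P"
  shows "(\<Sum>n\<in>composed_upto (insert q P) Z. 1 / real n)
    = (\<Sum>n\<in>composed_upto P Z. 1 / real n)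
      + 1 / real q * (\<Sum>n\<in>composed_upto (insert q P) (Z div q). 1 / real n)"
proof -
  have q0: "q > 0" using q by (simp add: prime_gt_0_nat)
  have eq: "composed_upto (insert q P) Z
      = composed_upto P Z \<union> (\<lambda>n. q * n) ` composed_upto (insert q P) (Z div q)"
  proof (intro equalityI subsetI)
    fix n assume n: "n \<in> composed_upto (insert q P) Z"
    show "n \<in> composed_upto P Z \<union> (\<lambda>n. q * n) ` composed_upto (insert q P) (Z div q)"
    proof (cases "q dvd n")
      case True
      then obtain m where m: "n = q * m" by blast
      then have m0: "m > 0" using n by (auto simp: composed_upto_def intro: Nat.gr0I)
      then have "m \<in> composed_upto (insert q P) (Z div q)"
        using n q q0 by (auto simp: m composed_upto_def prime_factors_prime_mult mult_le_iff_le_div)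
      with m show ?thesis by blast
    next
      case False
      then have "q \<notin> prime_factors n" by auto
      then show ?thesis using n by (auto simp: composed_upto_def)
    qed
  next
    fix n assume "n \<in> composed_upto P Z \<union> (\<lambda>n. q * n) ` composed_upto (insert q P) (Z div q)"
    then show "n \<in> composed_upto (insert q P) Z"
      using q q0 by (auto simp: composed_upto_def prime_factors_prime_mult mult_le_iff_le_div)
  qed
  have "composed_upto P Z \<inter> (\<lambda>n. q * n) ` composed_upto (insert q P) (Z div q) = {}"
    using q by (auto simp: composed_upto_def prime_factors_prime_mult)
  then have "(\<Sum>n\<in>composed_upto (insert q P) Z. 1 / real n)
    = (\<Sum>n\<in>composed_upto P Z. 1 / real n)
      + (\<Sum>n\<in>(\<lambda>n. q * n) ` composed_upto (insert q P) (Z div q). 1 / real n)"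
    unfolding eq by (intro sum.union_disjoint) auto
  also have "(\<Sum>n\<in>(\<lambda>n. q * n) ` composed_upto (insert q P) (Z div q). 1 / real n)
      = 1 / real q * (\<Sum>n\<in>composed_upto (insert q P) (Z div q). 1 / real n)"
    using q0 by (subst sum.reindex) (auto intro!: inj_onI simp: sum_distrib_left)
  finally show ?thesis .
qed

lemma sum_inverse_insert_le:
  assumes q: "prime q" "q \<notin> P"
  shows "(\<Sum>n\<in>composed_upto (insert q P) Z. 1 / real n)
    \<le> real q / (real q - 1) * (\<Sum>n\<in>composed_upto P Z. 1 / real n)"
proof -
  have q1: "real q > 1" using q prime_gt_1_nat[of q] by simp
  have "(\<Sum>n\<in>composed_upto (insert q P) (Z div q). 1 / real n)
      \<le> (\<Sum>n\<in>composed_upto (insert q P) Z. 1 / real n)"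
    using div_le_dividend[of Z q]
    by (intro sum_mono2) (auto simp: composed_upto_def simp del: div_le_dividend)
  then have "1 / real q * (\<Sum>n\<in>composed_upto (insert q P) (Z div q). 1 / real n)
      \<le> 1 / real q * (\<Sum>n\<in>composed_upto (insert q P) Z. 1 / real n)"
    by (intro mult_left_mono) auto
  with sum_inverse_insert[OF q, of Z] q1 show ?thesis by (simp add: field_simps)
qed

text \<open>The moduli divisible by \<open>q\<close> are \<open>q r\<close> with \<open>r\<close> a modulus prime to \<open>q\<close>, and \<open>\<phi>(q r) = (q - 1) \<phi>(r)\<close>.\<close>
lemma sieve_sum_insert:
  assumes q: "prime q" "q \<notin> P"
  shows "sieve_sum (insert q P) Z = sieve_sum P Z + sieve_sum P (Z div q) / (real q - 1)"
proof -
  have q0: "q > 0" and q1: "q > 1" using prime_gt_1_nat[OF q(1)] by simp_all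
  have cop: "coprime q n" if "n \<in> sieve_moduli P Y" for n Y
    using that q by (intro prime_imp_coprime) (auto simp: sieve_moduli_def prime_factors_dvd)
  have eq: "sieve_moduli (insert q P) Z
      = sieve_moduli P Z \<union> (\<lambda>n. q * n) ` sieve_moduli P (Z div q)"
  proof (intro equalityI subsetI)
    fix n assume n: "n \<in> sieve_moduli (insert q P) Z"
    show "n \<in> sieve_moduli P Z \<union> (\<lambda>n. q * n) ` sieve_moduli P (Z div q)"
    proof (cases "q dvd n")
      case True
      then obtain m where m: "n = q * m" by blast
      then have m0: "m > 0" using n by (auto simp: sieve_moduli_def intro: Nat.gr0I)
      have sq: "squarefree (q * m)" using n m by (simp add: sieve_moduli_def)
      have "\<not> q dvd m"
      proof
        assume "q dvd m"
        then have "q ^ 2 dvd q * m" by (simp add: power2_eq_square)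
        with sq have "q dvd 1" by (rule squarefreeD)
        with q1 show False by simp
      qed
      then have "q \<notin> prime_factors m" by auto
      moreover have "squarefree m" using sq by (rule squarefree_multD)
      ultimately have "m \<in> sieve_moduli P (Z div q)"
        using n q q0 m0 by (auto simp: m sieve_moduli_def prime_factors_prime_mult mult_le_iff_le_div)
      with m show ?thesis by blast
    next
      case False
      then have "q \<notin> prime_factors n" by auto
      then show ?thesis using n by (auto simp: sieve_moduli_def)
    qed
  next
    fix n assume "n \<in> sieve_moduli P Z \<union> (\<lambda>n. q * n) ` sieve_moduli P (Z div q)"
    then show "n \<in> sieve_moduli (insert q P) Z"
    proof
      assume "n \<in> (\<lambda>n. q * n) ` sieve_moduli P (Z div q)"
      then obtain m where m: "n = q * m" "m \<in> sieve_moduli P (Z div q)" by blast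
      have "squarefree (q * m)"
        using m cop[OF m(2)] q by (intro squarefree_mult_coprime) (auto simp: sieve_moduli_def squarefree_prime)
      then show ?thesis
        using m q q0 by (auto simp: sieve_moduli_def prime_factors_prime_mult mult_le_iff_le_div)
    qed (auto simp: sieve_moduli_def)
  qed
  have "sieve_moduli P Z \<inter> (\<lambda>n. q * n) ` sieve_moduli P (Z div q) = {}"
    using q by (auto simp: sieve_moduli_def prime_factors_prime_mult)
  then have "sieve_sum (insert q P) Z
      = sieve_sum P Z + (\<Sum>r\<in>(\<lambda>n. q * n) ` sieve_moduli P (Z div q). 1 / real (totient r))"
    unfolding eq sieve_sum_def by (intro sum.union_disjoint) auto
  also have "(\<Sum>r\<in>(\<lambda>n. q * n) ` sieve_moduli P (Z div q). 1 / real (totient r))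
      = (\<Sum>r\<in>sieve_moduli P (Z div q). 1 / real (totient (q * r)))"
    using q0 by (subst sum.reindex) (auto intro!: inj_onI)
  also have "\<dots> = (\<Sum>r\<in>sieve_moduli P (Z div q). 1 / real (totient r) / (real q - 1))"
  proof (intro sum.cong refl)
    fix r assume r: "r \<in> sieve_moduli P (Z div q)"
    have "totient (q * r) = (q - 1) * totient r"
      using cop[OF r] q by (simp only: totient_mult_coprime totient_prime)
    then show "1 / real (totient (q * r)) = 1 / real (totient r) / (real q - 1)"
      using q1 by (simp add: of_nat_diff)
  qed
  also have "\<dots> = sieve_sum P (Z div q) / (real q - 1)"
    by (simp add: sieve_sum_def sum_divide_distrib)
  finally show ?thesis .
qed

text \<open>
  For squarefree \<open>r\<close> the quotient \<open>1/\<phi>(r)\<close> is the sum of \<open>1/n\<close> over all \<open>n\<close> with the same prime factors as \<open>r\<close>.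
  The induction over the primes avoids these infinite sums.
\<close>
lemma sum_inverse_le_sieve_sum:
  assumes "finite P" "\<And>p. p \<in> P \<Longrightarrow> prime p"
  shows "(\<Sum>n\<in>composed_upto P Z. 1 / real n) \<le> sieve_sum P Z"
  using assms
proof (induction P arbitrary: Z rule: finite_induct)
  case empty
  have "composed_upto {} Z = {1..Z} \<inter> {1}" "sieve_moduli {} Z = {1..Z} \<inter> {1}"
    by (auto simp: composed_upto_def sieve_moduli_def prime_factorization_empty_iff)
  then show ?case by (auto simp: sieve_sum_def)
next
  case (insert q P)
  have q: "prime q" "q \<notin> P" using insert by auto
  have q1: "real q > 1" using q prime_gt_1_nat[of q] by simp
  have IH: "(\<Sum>n\<in>composed_upto P Y. 1 / real n) \<le> sieve_sum P Y" for Y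
    using insert by auto
  have "1 / real q * (\<Sum>n\<in>composed_upto (insert q P) (Z div q). 1 / real n)
      \<le> 1 / real q * (real q / (real q - 1) * (\<Sum>n\<in>composed_upto P (Z div q). 1 / real n))"
    using q1 by (intro mult_left_mono sum_inverse_insert_le[OF q]) auto
  also have "\<dots> = (\<Sum>n\<in>composed_upto P (Z div q). 1 / real n) / (real q - 1)"
    using q1 by simp
  also have "\<dots> \<le> sieve_sum P (Z div q) / (real q - 1)"
    using q1 IH by (intro divide_right_mono) auto
  finally show ?case
    using IH[of Z] by (simp only: sum_inverse_insert[OF q, of Z] sieve_sum_insert[OF q, of Z] add_mono)
qed

lemma sum_inverse_union_le:
  assumes "finite P" "\<And>p. p \<in> P \<Longrightarrow> prime p" "P \<inter> Q = {}"
  shows "(\<Sum>n\<in>composed_upto (P \<union> Q) Z. 1 / real n)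
    \<le> (\<Prod>p\<in>P. real p / (real p - 1)) * (\<Sum>n\<in>composed_upto Q Z. 1 / real n)"
  using assms
proof (induction P rule: finite_induct)
  case (insert q P)
  have q: "prime q" "q \<notin> P \<union> Q" using insert.prems insert.hyps by auto
  have q1: "real q > 1" using q prime_gt_1_nat[of q] by simp
  have "(\<Sum>n\<in>composed_upto (insert q (P \<union> Q)) Z. 1 / real n)
      \<le> real q / (real q - 1) * (\<Sum>n\<in>composed_upto (P \<union> Q) Z. 1 / real n)"
    by (rule sum_inverse_insert_le[OF q])
  also have "\<dots> \<le> real q / (real q - 1)
      * ((\<Prod>p\<in>P. real p / (real p - 1)) * (\<Sum>n\<in>composed_upto Q Z. 1 / real n))"
    using insert q1 by (intro mult_left_mono divide_nonneg_nonneg) auto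
  finally show ?case using insert by (simp add: mult_ac)
qed simp

text \<open>
  All integers up to \<open>Z\<close> are composed of primes up to \<open>y\<close> and primes between \<open>y\<close> and \<open>Z\<close>. The
  former contribute at most their Euler product, the latter the sieve sum.
\<close>
lemma ln_le_sieve_sum:
  "ln (real Z + 1) \<le> (\<Prod>p\<in>primes_upto y. real p / (real p - 1))
    * sieve_sum (primes_upto Z - primes_upto y) Z"
proof -
  define Q where "Q = primes_upto Z - primes_upto y"
  have "ln (real Z + 1) \<le> harm Z" by (rule ln_le_harm)
  also have "\<dots> = (\<Sum>n\<in>{1..Z}. 1 / real n)" by (simp add: harm_def inverse_eq_divide)
  also have "{1..Z} = composed_upto (primes_upto y \<union> Q) Z"
  proof -
    have "prime_factors n \<subseteq> primes_upto y \<union> Q" if "n \<in> {1..Z}" for n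
    proof
      fix p assume p: "p \<in> prime_factors n"
      then have "p \<le> n" using that by (intro dvd_imp_le) auto
      with p that show "p \<in> primes_upto y \<union> Q" by (auto simp: Q_def primes_upto_def)
    qed
    then show ?thesis unfolding composed_upto_def by blast
  qed
  also have "(\<Sum>n\<in>\<dots>. 1 / real n)
      \<le> (\<Prod>p\<in>primes_upto y. real p / (real p - 1)) * (\<Sum>n\<in>composed_upto Q Z. 1 / real n)"
    by (rule sum_inverse_union_le) (auto simp: Q_def prime_primes_upto)
  also have "\<dots> \<le> (\<Prod>p\<in>primes_upto y. real p / (real p - 1)) * sieve_sum Q Z"
  proof (intro mult_left_mono sum_inverse_le_sieve_sum prod_nonneg ballI divide_nonneg_nonneg)
    fix p assume "p \<in> primes_upto y"
    then have "p > 1" using prime_gt_1_nat[of p] by (simp add: primes_upto_def)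
    then show "0 \<le> real p - 1" by simp
  qed (auto simp: Q_def prime_primes_upto)
  finally show ?thesis by (simp add: Q_def)
qed

section \<open>Ramanujan sums\<close>

definition ramanujan_sum :: "nat \<Rightarrow> int \<Rightarrow> complex"
  where "ramanujan_sum r n = (\<Sum>a\<in>totatives r. ee (of_int n * (real a / real r)))"

text \<open>The Moebius function on squarefree numbers.\<close>
definition parity_sign :: "nat \<Rightarrow> real"
  where "parity_sign r = (- 1) ^ card (prime_factors r)"

text \<open>Every fraction \<open>a/r\<close> has a unique reduced form, whose denominator divides \<open>r\<close>.\<close>
lemma sum_ramanujan_sum_divisors:
  assumes "r > 0"
  shows "(\<Sum>d | d dvd r. ramanujan_sum d n) = (\<Sum>a=1..r. ee (of_int n * (real a / real r)))"
proof -
  define A where "A d = {k\<in>{0<..r}. gcd k r = d}" for d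
  define f where "f a = ee (of_int n * (real a / real r))" for a
  have inner: "sum f (A d) = ramanujan_sum (r div d) n" if d: "d dvd r" for d
  proof -
    have "sum f (A d) = (\<Sum>k\<in>totatives (r div d). f (k * d))"
      unfolding A_def
      by (rule sum.reindex_bij_betw[symmetric, OF bij_betw_totatives_gcd_eq[OF d assms]])
    also have "\<dots> = ramanujan_sum (r div d) n"
      unfolding ramanujan_sum_def
    proof (intro sum.cong refl)
      fix k
      have "d > 0" using d assms by (auto intro: Nat.gr0I)
      then have "real (k * d) / real r = real k / real (r div d)"
        using d assms by (auto elim!: dvdE)
      then show "f (k * d) = ee (of_int n * (real k / real (r div d)))" by (simp only: f_def)
    qed
    finally show ?thesis .
  qed
  have "{1..r} = (\<Union>d\<in>{d. d dvd r}. A d)" by safe (auto simp: A_def)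
  then have "sum f {1..r} = (\<Sum>d | d dvd r. sum f (A d))"
    using assms by (simp only:, intro sum.UNION_disjoint) (auto simp: A_def)
  also have "\<dots> = (\<Sum>d | d dvd r. ramanujan_sum (r div d) n)"
    by (intro sum.cong refl inner) simp
  also have "\<dots> = (\<Sum>d | d dvd r. ramanujan_sum d n)" using assms
    by (intro sum.reindex_bij_witness[of _ "(div) r" "(div) r"]) (auto elim: dvdE)
  finally show ?thesis by (simp add: f_def)
qed

lemma ee_eq_1_imp_int:
  assumes "ee t = 1" shows "t = of_int (round t)"
  using cmod_ee_minus_1[of t] assms by (simp add: dist_int_eq_round)

lemma sum_all_residues_eq_0:
  assumes r: "r > 1" and cop: "coprime n (int r)"
  shows "(\<Sum>a=1..r. ee (of_int n * (real a / real r))) = 0"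
proof -
  define w where "w = ee (of_int n / real r)"
  have w: "ee (of_int n * (real a / real r)) = w ^ a" for a
    unfolding w_def ee_mult_nat[symmetric] by (simp add: mult.commute)
  have "w \<noteq> 1"
  proof
    assume "w = 1"
    then have "of_int n / real r = of_int (round (of_int n / real r))"
      unfolding w_def by (rule ee_eq_1_imp_int)
    then have "real_of_int n = of_int (round (of_int n / real r)) * real r"
      using r by (simp add: field_simps)
    then have "real_of_int n = of_int (round (of_int n / real r) * int r)" by simp
    then have "n = round (of_int n / real r) * int r" by (simp only: of_int_eq_iff)
    then have "int r dvd n" by (metis dvd_triv_right)
    then have "int r dvd 1" using cop by (meson coprime_common_divisor dvd_refl)
    with r show False by simp
  qed
  moreover have "w ^ r = 1"
    using r unfolding w[symmetric] by simp
  ultimately have "(\<Sum>a<r. w ^ a) = 0" by (simp add: sum_gp_strict)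
  moreover have "(\<Sum>a=1..r. w ^ a) = (\<Sum>a<r. w ^ Suc a)"
    by (rule sum.reindex_bij_witness[of _ Suc "\<lambda>a. a - 1"]) auto
  moreover have "(\<Sum>a<r. w ^ Suc a) = w * (\<Sum>a<r. w ^ a)" by (simp add: sum_distrib_left)
  ultimately have "(\<Sum>a=1..r. w ^ a) = 0" by simp
  then show ?thesis unfolding w .
qed

text \<open>
  The divisors of \<open>p r\<close> are the divisors \<open>d\<close> of \<open>r\<close> and their multiples \<open>p d\<close>, and the Ramanujan sums
  over all of them add up to \<open>0\<close>. By induction the contributions of \<open>d\<close> and \<open>p d\<close> cancel for all
  \<open>d < r\<close>, hence also for \<open>d = r\<close>.
\<close>
lemma ramanujan_sum_prime_mult:
  assumes p: "prime p" and "r > 0" "\<not> p dvd r" "coprime n (int (p * r))"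
  shows "ramanujan_sum (p * r) n = - ramanujan_sum r n"
  using assms(2-4)
proof (induction r rule: less_induct)
  case (less r)
  have p1: "p > 1" using p by (rule prime_gt_1_nat)
  define D where "D = {d. d dvd r}"
  have fin: "finite D" unfolding D_def using less.prems by (intro finite_divisors_nat) auto
  have "{d. d dvd p * r} = D \<union> (*) p ` D"
  proof (intro equalityI subsetI)
    fix d assume d: "d \<in> {d. d dvd p * r}"
    show "d \<in> D \<union> (*) p ` D"
    proof (cases "p dvd d")
      case True
      then obtain c where "d = p * c" by blast
      with d p1 show ?thesis by (auto simp: D_def)
    next
      case False
      with p have "coprime p d" by (rule prime_imp_coprime)
      then have "coprime d p" by (simp add: coprime_commute)
      with d show ?thesis by (simp add: D_def coprime_dvd_mult_right_iff)
    qed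
  qed (auto simp: D_def)
  moreover have "D \<inter> (*) p ` D = {}"
    using less.prems by (auto simp: D_def dest: dvd_mult_left)
  ultimately have "(\<Sum>d | d dvd p * r. ramanujan_sum d n)
      = (\<Sum>d\<in>D. ramanujan_sum d n) + (\<Sum>d\<in>(*) p ` D. ramanujan_sum d n)"
    using fin by (simp add: sum.union_disjoint)
  also have "(\<Sum>d\<in>(*) p ` D. ramanujan_sum d n) = (\<Sum>d\<in>D. ramanujan_sum (p * d) n)"
    using p1 by (subst sum.reindex) (auto intro: inj_onI)
  also have "(\<Sum>d | d dvd p * r. ramanujan_sum d n) = 0"
  proof -
    have "p * r > 1" using p1 less.prems by (metis less_le_trans mult.commute mult_le_mono1 mult_1 Suc_leI One_nat_def)
    then have "(\<Sum>a=1..p * r. ee (of_int n * (real a / real (p * r)))) = 0"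
      using less.prems(3) by (rule sum_all_residues_eq_0)
    moreover have "p * r > 0" using \<open>p * r > 1\<close> by linarith
    ultimately show ?thesis by (simp only: sum_ramanujan_sum_divisors)
  qed
  finally have "(\<Sum>d\<in>D. ramanujan_sum d n + ramanujan_sum (p * d) n) = 0"
    by (simp add: sum.distrib)
  moreover have "(\<Sum>d\<in>D - {r}. ramanujan_sum d n + ramanujan_sum (p * d) n) = 0"
  proof (intro sum.neutral ballI)
    fix d assume d: "d \<in> D - {r}"
    then have "d dvd r" "d \<noteq> r" by (auto simp: D_def)
    then have "d < r" using less.prems by (metis dvd_imp_le le_neq_implies_less)
    moreover have "d > 0" using \<open>d dvd r\<close> less.prems by (auto intro: Nat.gr0I)
    moreover have "\<not> p dvd d" using \<open>d dvd r\<close> less.prems by (auto dest: dvd_trans)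
    moreover have "coprime n (int (p * d))"
    proof -
      have "int (p * d) dvd int (p * r)" using \<open>d dvd r\<close> by (intro of_nat_dvd_iff[THEN iffD2] mult_dvd_mono) auto
      with less.prems show ?thesis by (meson coprime_divisors dvd_refl)
    qed
    ultimately show "ramanujan_sum d n + ramanujan_sum (p * d) n = 0" using less.IH by simp
  qed
  moreover have "r \<in> D" by (simp add: D_def)
  ultimately have "ramanujan_sum r n + ramanujan_sum (p * r) n = 0"
    using fin by (simp add: sum.remove)
  then show ?case by (simp add: eq_neg_iff_add_eq_0 add.commute)
qed

lemma ramanujan_sum_coprime:
  assumes "r > 0" "squarefree r" "coprime n (int r)"
  shows "ramanujan_sum r n = of_real (parity_sign r)"
  using assms
proof (induction r rule: less_induct)
  case (less r)
  show ?case
  proof (cases "r = 1")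
    case True
    then show ?thesis by (simp add: ramanujan_sum_def parity_sign_def)
  next
    case False
    then obtain p where p: "prime p" "p dvd r" using prime_factor_nat by blast
    then obtain m where m: "r = p * m" by blast
    have m0: "m > 0" using m less.prems by (auto intro: Nat.gr0I)
    have p1: "p > 1" using p(1) by (rule prime_gt_1_nat)
    have "\<not> p dvd m"
    proof
      assume "p dvd m"
      then have "p ^ 2 dvd r" by (simp add: power2_eq_square m)
      with less.prems(2) have "p dvd 1" by (rule squarefreeD)
      with p1 show False by simp
    qed
    moreover have "squarefree m" using less.prems(2) unfolding m by (rule squarefree_multD)
    moreover have "coprime n (int m)" using less.prems(3) by (simp add: m)
    moreover have "m < r" using m m0 p1 by simp
    ultimately have "ramanujan_sum m n = of_real (parity_sign m)" using less.IH m0 by simp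
    moreover have "ramanujan_sum r n = - ramanujan_sum m n"
      unfolding m using p \<open>\<not> p dvd m\<close> m0 less.prems(3) m by (intro ramanujan_sum_prime_mult) auto
    moreover have "parity_sign r = - parity_sign m"
    proof -
      have "p \<notin> prime_factors m" using \<open>\<not> p dvd m\<close> by auto
      then show ?thesis
        using m0 p by (simp only: parity_sign_def m prime_factors_prime_mult) simp
    qed
    ultimately show ?thesis by simp
  qed
qed

section \<open>The enveloping sieve\<close>

text \<open>
  The pair \<open>(r, a)\<close> stands for the reduced fraction \<open>a/r\<close> in \<open>(0, 1]\<close>; keeping the pair makes the
  denominator accessible.
\<close>
definition sieve_freqs :: "nat set \<Rightarrow> nat \<Rightarrow> (nat \<times> nat) set"
  where "sieve_freqs P Z = Sigma (sieve_moduli P Z) totatives"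

definition freq :: "nat \<times> nat \<Rightarrow> real"
  where "freq \<phi> = real (snd \<phi>) / real (fst \<phi>)"

text \<open>The coefficients \<open>\<mu>(r)/(G \<phi>(r))\<close> of a trigonometric polynomial that equals \<open>1\<close> at the integers coprime to all moduli.\<close>
definition freq_weight :: "nat set \<Rightarrow> nat \<Rightarrow> nat \<times> nat \<Rightarrow> real"
  where "freq_weight P Z \<phi> = parity_sign (fst \<phi>) / (sieve_sum P Z * real (totient (fst \<phi>)))"

lemma finite_sieve_freqs [simp]: "finite (sieve_freqs P Z)"
  by (simp add: sieve_freqs_def)

lemma sieve_moduli_pos: "r \<in> sieve_moduli P Z \<Longrightarrow> r > 0"
  by (simp add: sieve_moduli_def)

lemma sieve_sum_ge_1:
  assumes "Z \<ge> 1" shows "sieve_sum P Z \<ge> 1"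
proof -
  have "(\<Sum>r\<in>{1}. 1 / real (totient r)) \<le> sieve_sum P Z"
    unfolding sieve_sum_def using assms by (intro sum_mono2) (auto simp: sieve_moduli_def)
  then show ?thesis by simp
qed

lemma abs_parity_sign [simp]: "\<bar>parity_sign r\<bar> = 1"
  by (simp add: parity_sign_def power_abs)

text \<open>Each Ramanujan sum equals \<open>\<mu>(r)\<close> here, so the modulus \<open>r\<close> contributes \<open>1/(G \<phi>(r))\<close>, and these add up to \<open>1\<close>.\<close>
lemma sieve_weight_polynomial_eq_1:
  assumes "Z \<ge> 1" and cop: "\<And>r. r \<in> sieve_moduli P Z \<Longrightarrow> coprime n (int r)"
  shows "(\<Sum>\<phi>\<in>sieve_freqs P Z. of_real (freq_weight P Z \<phi>) * ee (of_int n * freq \<phi>)) = 1"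
proof -
  define G where "G = sieve_sum P Z"
  have G: "G \<ge> 1" unfolding G_def by (rule sieve_sum_ge_1[OF assms(1)])
  have "(\<Sum>\<phi>\<in>sieve_freqs P Z. of_real (freq_weight P Z \<phi>) * ee (of_int n * freq \<phi>))
      = (\<Sum>r\<in>sieve_moduli P Z. of_real (parity_sign r / (G * real (totient r))) * ramanujan_sum r n)"
    unfolding sieve_freqs_def ramanujan_sum_def sum_distrib_left
    by (subst sum.Sigma) (auto simp: freq_weight_def freq_def G_def intro!: sum.cong)
  also have "\<dots> = (\<Sum>r\<in>sieve_moduli P Z. of_real (1 / real (totient r) / G))"
  proof (intro sum.cong refl)
    fix r assume r: "r \<in> sieve_moduli P Z"
    then have "ramanujan_sum r n = of_real (parity_sign r)"
      using cop[OF r] by (intro ramanujan_sum_coprime) (auto simp: sieve_moduli_def)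
    moreover have "parity_sign r * parity_sign r = 1"
      using abs_parity_sign[of r] by (metis abs_mult_self_eq mult_1)
    ultimately show "of_real (parity_sign r / (G * real (totient r))) * ramanujan_sum r n
        = of_real (1 / real (totient r) / G)"
      by (simp add: mult.commute flip: of_real_mult of_real_divide)
  qed
  also have "\<dots> = of_real (sieve_sum P Z / G)"
    by (simp add: sieve_sum_def sum_divide_distrib)
  also have "\<dots> = 1" using G by (simp add: G_def)
  finally show ?thesis .
qed

text \<open>The predicate \<open>K\<close> allows the restriction to the moduli divisible by a given prime.\<close>
lemma sum_freq_weight_squares:
  fixes K :: "nat \<Rightarrow> bool"
  assumes "Z \<ge> 1"
  shows "(\<Sum>\<phi>\<in>{\<phi>\<in>sieve_freqs P Z. K (fst \<phi>)}. (freq_weight P Z \<phi>)\<^sup>2)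
    = (\<Sum>r\<in>{r\<in>sieve_moduli P Z. K r}. 1 / real (totient r)) / (sieve_sum P Z)\<^sup>2"
proof -
  have eq: "{\<phi>\<in>sieve_freqs P Z. K (fst \<phi>)} = Sigma {r\<in>sieve_moduli P Z. K r} totatives"
    by (auto simp: sieve_freqs_def)
  have "(\<Sum>\<phi>\<in>{\<phi>\<in>sieve_freqs P Z. K (fst \<phi>)}. (freq_weight P Z \<phi>)\<^sup>2)
      = (\<Sum>r\<in>{r\<in>sieve_moduli P Z. K r}. \<Sum>a\<in>totatives r. (freq_weight P Z (r, a))\<^sup>2)"
    unfolding eq by (subst sum.Sigma) auto
  also have "\<dots> = (\<Sum>r\<in>{r\<in>sieve_moduli P Z. K r}. 1 / real (totient r) / (sieve_sum P Z)\<^sup>2)"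
  proof (intro sum.cong refl)
    fix r assume "r \<in> {r\<in>sieve_moduli P Z. K r}"
    then have "r > 0" using sieve_moduli_pos[of r P Z] by simp
    then have t: "real (totient r) > 0" by simp
    have "(parity_sign r)\<^sup>2 = 1" using abs_parity_sign[of r] by (metis power2_abs power_one)
    then have "(\<Sum>a\<in>totatives r. (freq_weight P Z (r, a))\<^sup>2)
        = real (totient r) * (1 / ((sieve_sum P Z)\<^sup>2 * (real (totient r))\<^sup>2))"
      by (simp add: freq_weight_def power_divide power_mult_distrib totient_def)
    with t show "(\<Sum>a\<in>totatives r. (freq_weight P Z (r, a))\<^sup>2)
        = 1 / real (totient r) / (sieve_sum P Z)\<^sup>2"
      by (simp add: power2_eq_square)
  qed
  finally show ?thesis by (simp add: sum_divide_distrib)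
qed

lemma sum_freq_weight_squares_all:
  assumes "Z \<ge> 1"
  shows "(\<Sum>\<phi>\<in>sieve_freqs P Z. (freq_weight P Z \<phi>)\<^sup>2) = 1 / sieve_sum P Z"
  using sum_freq_weight_squares[OF assms, of P "\<lambda>_. True"] sieve_sum_ge_1[OF assms, of P]
  by (simp add: power2_eq_square flip: sieve_sum_def)

text \<open>Dividing by \<open>p\<close> maps the moduli divisible by \<open>p\<close> injectively to moduli and divides \<open>\<phi>\<close> by \<open>p - 1 \<ge> y\<close>.\<close>
lemma sum_moduli_multiple_le:
  assumes p: "prime p" and P: "\<And>q. q \<in> P \<Longrightarrow> q > y" and y: "y \<ge> 1"
  shows "(\<Sum>r\<in>{r\<in>sieve_moduli P Z. p dvd r}. 1 / real (totient r)) \<le> sieve_sum P Z / real y"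
proof (cases "p \<in> P")
  case False
  then have empty: "{r\<in>sieve_moduli P Z. p dvd r} = {}"
    using p by (auto simp: sieve_moduli_def prime_factors_dvd)
  show ?thesis unfolding empty by (simp add: sieve_sum_def sum_nonneg)
next
  case True
  have p1: "p > 1" using p by (rule prime_gt_1_nat)
  define A where "A = {r\<in>sieve_moduli P Z. p dvd r}"
  have A: "r div p \<in> sieve_moduli P Z \<and> totient r = (p - 1) * totient (r div p)" if "r \<in> A" for r
  proof -
    from that obtain m where m: "r = p * m" by (auto simp: A_def)
    have r: "squarefree r" "r \<le> Z" "r > 0" "prime_factors r \<subseteq> P"
      using that by (auto simp: A_def sieve_moduli_def)
    have m0: "m > 0" using m r by (auto intro: Nat.gr0I)
    have "\<not> p dvd m"
    proof
      assume "p dvd m"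
      then have "p ^ 2 dvd r" by (simp add: power2_eq_square m)
      with r(1) have "p dvd 1" by (rule squarefreeD)
      with p1 show False by simp
    qed
    then have "coprime p m" using p by (rule prime_imp_coprime[rotated])
    then have "totient r = (p - 1) * totient m"
      using p by (simp only: m totient_mult_coprime totient_prime)
    moreover have "squarefree m" using r(1) unfolding m by (rule squarefree_multD)
    moreover have "m \<le> Z" using r(2) p1 m by (metis dvd_imp_le dvd_triv_right le_trans r(3))
    moreover have "prime_factors m \<subseteq> P"
      using r(4) p m0 by (simp add: m prime_factors_prime_mult)
    ultimately show ?thesis using m p1 m0 by (simp add: sieve_moduli_def)
  qed
  have inj: "inj_on (\<lambda>r. r div p) A"
    by (rule inj_onI) (auto simp: A_def elim!: dvdE)
  have "(\<Sum>r\<in>A. 1 / real (totient r)) \<le> (\<Sum>r\<in>A. 1 / real (totient (r div p)) / real y)"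
  proof (intro sum_mono)
    fix r assume r: "r \<in> A"
    have "r div p > 0" using A[OF r] by (simp add: sieve_moduli_def)
    then have t: "real (totient (r div p)) > 0" by simp
    have "y \<le> p - 1" using P[OF True] by simp
    then have "real y * real (totient (r div p)) \<le> real (p - 1) * real (totient (r div p))"
      by (intro mult_right_mono) auto
    also have "\<dots> = real (totient r)" using A[OF r] by simp
    finally have "real y * real (totient (r div p)) \<le> real (totient r)" .
    moreover have "real y * real (totient (r div p)) > 0" using t y by simp
    ultimately have "1 / real (totient r) \<le> 1 / (real y * real (totient (r div p)))"
      by (intro frac_le) auto
    then show "1 / real (totient r) \<le> 1 / real (totient (r div p)) / real y"
      by (simp add: mult.commute)
  qed
  also have "\<dots> = (\<Sum>r\<in>(\<lambda>r. r div p) ` A. 1 / real (totient r)) / real y"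
    by (subst sum.reindex[OF inj]) (simp add: sum_divide_distrib)
  also have "\<dots> \<le> sieve_sum P Z / real y"
    unfolding sieve_sum_def using A by (intro divide_right_mono sum_mono2) auto
  finally show ?thesis by (simp add: A_def)
qed

lemma freq_bounds:
  assumes "\<phi> \<in> sieve_freqs P Z" shows "0 < freq \<phi>" "freq \<phi> \<le> 1"
  using assms sieve_moduli_pos[of "fst \<phi>" P Z]
  by (auto simp: sieve_freqs_def freq_def in_totatives_iff)

lemma freq_inj:
  assumes "\<phi> \<in> sieve_freqs P Z" "\<phi>' \<in> sieve_freqs P Z" "freq \<phi> = freq \<phi>'"
  shows "\<phi> = \<phi>'"
proof -
  obtain r a where \<phi>: "\<phi> = (r, a)" by (cases \<phi>)
  obtain s b where \<phi>': "\<phi>' = (s, b)" by (cases \<phi>')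
  have *: "r > 0" "s > 0" "coprime a r" "coprime b s"
    using assms(1,2) sieve_moduli_pos[of r P Z] sieve_moduli_pos[of s P Z]
    by (auto simp: \<phi> \<phi>' sieve_freqs_def in_totatives_iff)
  have "real (a * s) = real (b * r)"
    using assms(3) * by (simp add: \<phi> \<phi>' freq_def field_simps)
  then have "a * s = b * r" by (simp only: of_nat_eq_iff)
  then have "a = b \<and> s = r" using * by (subst (asm) coprime_crossproduct_nat) auto
  then show ?thesis by (simp add: \<phi> \<phi>')
qed

lemma frac_eq_imp:
  assumes "frac x = frac y" shows "\<exists>k::int. x = y + of_int k"
  using assms unfolding frac_def by (intro exI[of _ "\<lfloor>x\<rfloor> - \<lfloor>y\<rfloor>"]) simp

lemma freq_eq_of_int:
  assumes "\<phi> \<in> sieve_freqs P Z" "\<phi>' \<in> sieve_freqs P Z" "freq \<phi> = freq \<phi>' + of_int k"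
  shows "\<phi> = \<phi>'"
proof -
  have "\<bar>real_of_int k\<bar> < 1"
    using assms(3) freq_bounds[OF assms(1)] freq_bounds[OF assms(2)] by linarith
  then have "k = 0" by simp
  then show ?thesis using assms freq_inj by simp
qed

lemma denominator_mult_frac_int:
  assumes "\<phi> \<in> sieve_freqs P Z" "\<phi>' \<in> sieve_freqs P Z"
  shows "real (fst \<phi> * fst \<phi>') * frac (freq \<phi> - freq \<phi>') \<in> \<int>"
proof -
  have "fst \<phi> > 0" "fst \<phi>' > 0" using assms by (auto simp: sieve_freqs_def sieve_moduli_pos)
  then have "real (fst \<phi> * fst \<phi>') * frac (freq \<phi> - freq \<phi>')
      = of_int (int (snd \<phi> * fst \<phi>') - int (snd \<phi>' * fst \<phi>)
          - int (fst \<phi> * fst \<phi>') * \<lfloor>freq \<phi> - freq \<phi>'\<rfloor>)"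
    by (simp add: frac_def freq_def field_simps)
  then show ?thesis by (metis Ints_of_int)
qed

text \<open>The least denominator of a rational \<open>\<psi>\<close> that is not an integer has a prime factor, and it divides all other denominators.\<close>
lemma prime_dividing_denominators:
  fixes \<psi> :: real
  assumes \<psi>: "0 < \<psi>" "\<psi> < 1"
  shows "\<exists>p. prime p \<and> (\<forall>m>0. real m * \<psi> \<in> \<int> \<longrightarrow> p dvd m)"
proof (cases "\<exists>m>0. real m * \<psi> \<in> \<int>")
  case True
  define q where "q = (LEAST m. m > 0 \<and> real m * \<psi> \<in> \<int>)"
  have q: "q > 0" "real q * \<psi> \<in> \<int>"
    using LeastI_ex[OF True[unfolded conj_assoc]] by (auto simp: q_def)
  have dvd: "q dvd m" if m: "real m * \<psi> \<in> \<int>" for m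
  proof (rule ccontr)
    assume "\<not> q dvd m"
    then have "m mod q > 0" by (simp add: mod_greater_zero_iff_not_dvd)
    moreover have "real (m mod q) * \<psi> \<in> \<int>"
    proof -
      have "real m = real (m div q) * real q + real (m mod q)"
        by (metis div_mult_mod_eq of_nat_add of_nat_mult)
      then have "real (m mod q) * \<psi> = real m * \<psi> - real (m div q) * (real q * \<psi>)"
        by (simp add: algebra_simps)
      moreover have "real (m div q) \<in> \<int>" by (rule Ints_of_nat)
      ultimately show ?thesis using q m by (metis Ints_diff Ints_mult)
    qed
    ultimately have "q \<le> m mod q" unfolding q_def by (intro Least_le) auto
    with q show False using mod_less_divisor[of q m] by linarith
  qed
  have "q \<noteq> 1"
  proof
    assume "q = 1"
    with q obtain k :: int where "\<psi> = of_int k" by (auto elim: Ints_cases)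
    with \<psi> show False by simp
  qed
  then obtain p where "prime p" "p dvd q" using prime_factor_nat by blast
  then show ?thesis using dvd by (meson dvd_trans)
qed (use two_is_prime_nat in blast)

lemma weighted_am_gm: 
  fixes a b s :: real
  assumes "s > 0" shows "\<bar>a\<bar> * \<bar>b\<bar> \<le> (s * a\<^sup>2 + b\<^sup>2 / s) / 2"
proof -
  have "0 \<le> (s * \<bar>a\<bar> - \<bar>b\<bar>)\<^sup>2" by simp
  then have "2 * s * (\<bar>a\<bar> * \<bar>b\<bar>) \<le> s\<^sup>2 * a\<^sup>2 + b\<^sup>2"
    by (simp add: power2_diff power_mult_distrib mult_ac)
  then show ?thesis using assms by (simp add: field_simps power2_eq_square)
qed

text \<open>
  By \<open>prime_dividing_denominators\<close> a single prime \<open>p\<close> divides, for every pair of \<open>W\<close>, one of the two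
  denominators. Each component of a pair determines the other. So the sum over the pairs in which \<open>p\<close>
  divides the first denominator is at most, by the inequality of Cauchy and Schwarz, the geometric mean of
  the full sum of squares \<open>1/G\<close> and the sum of squares over the multiples of \<open>p\<close>, which is at most
  \<open>1/(G y)\<close>. The same holds for the second denominator.
\<close>
lemma correlation_le:
  assumes Z: "Z \<ge> 1" and P: "\<And>q. q \<in> P \<Longrightarrow> q > y" and y: "y \<ge> 1"
    and \<psi>: "0 < \<psi>" "\<psi> < 1"
    and W: "W \<subseteq> sieve_freqs P Z \<times> sieve_freqs P Z"
      "\<And>\<phi> \<phi>'. (\<phi>, \<phi>') \<in> W \<Longrightarrow> frac (freq \<phi> - freq \<phi>') = \<psi>"
  shows "(\<Sum>(\<phi>, \<phi>')\<in>W. \<bar>freq_weight P Z \<phi>\<bar> * \<bar>freq_weight P Z \<phi>'\<bar>)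
    \<le> 2 / (sieve_sum P Z * sqrt (real y))"
proof -
  define F where "F = sieve_freqs P Z"
  define G where "G = sieve_sum P Z"
  define \<alpha> where "\<alpha> = freq_weight P Z"
  have G: "G \<ge> 1" unfolding G_def by (rule sieve_sum_ge_1[OF Z])
  have y0: "real y > 0" using y by simp
  define s where "s = sqrt (real y)"
  have s: "s > 0" "s * s = real y" using y0 by (auto simp: s_def)
  obtain p where p: "prime p" "\<And>m. m > 0 \<Longrightarrow> real m * \<psi> \<in> \<int> \<Longrightarrow> p dvd m"
    using prime_dividing_denominators[OF \<psi>] by blast
  have finW: "finite W" by (rule finite_subset[OF W(1)]) auto
  have W_dvd: "p dvd fst \<phi> \<or> p dvd fst \<phi>'" if "(\<phi>, \<phi>') \<in> W" for \<phi> \<phi>'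
  proof -
    have F: "\<phi> \<in> F" "\<phi>' \<in> F" using W that by (auto simp: F_def)
    then have "fst \<phi> * fst \<phi>' > 0" by (auto simp: F_def sieve_freqs_def sieve_moduli_pos)
    moreover have "real (fst \<phi> * fst \<phi>') * \<psi> \<in> \<int>"
      using denominator_mult_frac_int[OF F[unfolded F_def]] W(2)[OF that] by simp
    ultimately have "p dvd fst \<phi> * fst \<phi>'" by (rule p(2))
    with p(1) show ?thesis by (simp add: prime_dvd_mult_iff)
  qed
  have inj1: "inj_on fst W"
  proof (rule inj_onI)
    fix u v assume uv: "u \<in> W" "v \<in> W" "fst u = fst v"
    obtain \<phi> \<phi>1 \<phi>2 where eq: "u = (\<phi>, \<phi>1)" "v = (\<phi>, \<phi>2)" using uv(3) by (metis prod.collapse)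
    have "frac (freq \<phi> - freq \<phi>1) = frac (freq \<phi> - freq \<phi>2)" using W(2) uv eq by simp
    then obtain k :: int where "freq \<phi> - freq \<phi>1 = freq \<phi> - freq \<phi>2 + of_int k"
      using frac_eq_imp by blast
    then have "freq \<phi>2 = freq \<phi>1 + of_int k" by simp
    then have "\<phi>2 = \<phi>1" by (rule freq_eq_of_int[rotated 2, of _ _ _ P Z]) (use W uv eq in auto)
    then show "u = v" by (simp add: eq)
  qed
  have inj2: "inj_on snd W"
  proof (rule inj_onI)
    fix u v assume uv: "u \<in> W" "v \<in> W" "snd u = snd v"
    obtain \<phi> \<phi>1 \<phi>2 where eq: "u = (\<phi>1, \<phi>)" "v = (\<phi>2, \<phi>)" using uv(3) by (metis prod.collapse)
    have "frac (freq \<phi>1 - freq \<phi>) = frac (freq \<phi>2 - freq \<phi>)" using W(2) uv eq by simp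
    then obtain k :: int where "freq \<phi>1 - freq \<phi> = freq \<phi>2 - freq \<phi> + of_int k"
      using frac_eq_imp by blast
    then have "freq \<phi>1 = freq \<phi>2 + of_int k" by simp
    then have "\<phi>1 = \<phi>2" by (rule freq_eq_of_int[rotated 2, of _ _ _ P Z]) (use W uv eq in auto)
    then show "u = v" by (simp add: eq)
  qed
  have sq_all: "(\<Sum>u\<in>V. (\<alpha> (g u))\<^sup>2) \<le> 1 / G"
    if "V \<subseteq> W" "inj_on g W" "g ` W \<subseteq> F" for V and g :: "_ \<Rightarrow> nat \<times> nat"
  proof -
    have "(\<Sum>u\<in>V. (\<alpha> (g u))\<^sup>2) = (\<Sum>\<phi>\<in>g ` V. (\<alpha> \<phi>)\<^sup>2)"
      using that by (subst sum.reindex) (auto intro: inj_on_subset)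
    also have "\<dots> \<le> (\<Sum>\<phi>\<in>F. (\<alpha> \<phi>)\<^sup>2)"
      using that by (intro sum_mono2) (auto simp: F_def)
    finally show ?thesis
      using sum_freq_weight_squares_all[OF Z, of P] by (simp add: F_def G_def \<alpha>_def)
  qed
  have sq_p: "(\<Sum>u\<in>V. (\<alpha> (g u))\<^sup>2) \<le> 1 / (G * real y)"
    if "V \<subseteq> W" "inj_on g W" "g ` W \<subseteq> F" "\<And>u. u \<in> V \<Longrightarrow> p dvd fst (g u)"
    for V and g :: "_ \<Rightarrow> nat \<times> nat"
  proof -
    have "(\<Sum>u\<in>V. (\<alpha> (g u))\<^sup>2) = (\<Sum>\<phi>\<in>g ` V. (\<alpha> \<phi>)\<^sup>2)"
      using that by (subst sum.reindex) (auto intro: inj_on_subset)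
    also have "\<dots> \<le> (\<Sum>\<phi>\<in>{\<phi>\<in>F. p dvd fst \<phi>}. (\<alpha> \<phi>)\<^sup>2)"
      using that by (intro sum_mono2) (auto simp: F_def)
    also have "\<dots> = (\<Sum>r\<in>{r\<in>sieve_moduli P Z. p dvd r}. 1 / real (totient r)) / G\<^sup>2"
      unfolding F_def G_def \<alpha>_def by (rule sum_freq_weight_squares[OF Z])
    also have "\<dots> \<le> (G / real y) / G\<^sup>2"
      unfolding G_def by (intro divide_right_mono sum_moduli_multiple_le p P y) auto
    also have "\<dots> = 1 / (G * real y)" using G by (simp add: power2_eq_square)
    finally show ?thesis .
  qed
  have img: "fst ` W \<subseteq> F" "snd ` W \<subseteq> F" using W(1) by (auto simp: F_def)
  \<comment> \<open>The weight \<open>s = \<surd>y\<close> balances the two sums of squares, which are at most \<open>1/(G y)\<close> and \<open>1/G\<close>.\<close>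
  have half: "(\<Sum>u\<in>V. \<bar>\<alpha> (g u)\<bar> * \<bar>\<alpha> (h u)\<bar>) \<le> 1 / (G * s)"
    if "V \<subseteq> W" "inj_on g W" "g ` W \<subseteq> F" "inj_on h W" "h ` W \<subseteq> F" "\<And>u. u \<in> V \<Longrightarrow> p dvd fst (g u)"
    for V and g h :: "_ \<Rightarrow> nat \<times> nat"
  proof -
    have "(\<Sum>u\<in>V. \<bar>\<alpha> (g u)\<bar> * \<bar>\<alpha> (h u)\<bar>) \<le> (\<Sum>u\<in>V. (s * (\<alpha> (g u))\<^sup>2 + (\<alpha> (h u))\<^sup>2 / s) / 2)"
      by (intro sum_mono weighted_am_gm s)
    also have "\<dots> = (s * (\<Sum>u\<in>V. (\<alpha> (g u))\<^sup>2) + (\<Sum>u\<in>V. (\<alpha> (h u))\<^sup>2) / s) / 2"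
      by (simp add: sum.distrib sum_distrib_left flip: sum_divide_distrib)
    also have "\<dots> \<le> (s * (1 / (G * real y)) + (1 / G) / s) / 2"
      using s by (intro divide_right_mono add_mono mult_left_mono sq_p sq_all that) auto
    also have "\<dots> = 1 / (G * s)"
      using s G unfolding s(2)[symmetric] by (simp add: field_simps)
    finally show ?thesis .
  qed
  define W1 where "W1 = {u\<in>W. p dvd fst (fst u)}"
  have "(\<Sum>u\<in>W. \<bar>\<alpha> (fst u)\<bar> * \<bar>\<alpha> (snd u)\<bar>)
      = (\<Sum>u\<in>W - W1. \<bar>\<alpha> (snd u)\<bar> * \<bar>\<alpha> (fst u)\<bar>) + (\<Sum>u\<in>W1. \<bar>\<alpha> (fst u)\<bar> * \<bar>\<alpha> (snd u)\<bar>)"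
    using sum.subset_diff[of W1 W] finW by (simp add: W1_def mult.commute)
  also have "\<dots> \<le> 1 / (G * s) + 1 / (G * s)"
  proof (intro add_mono half inj1 inj2 img)
    fix u assume "u \<in> W - W1"
    then show "p dvd fst (snd u)" using W_dvd[of "fst u" "snd u"] by (simp add: W1_def)
  qed (auto simp: W1_def)
  finally have "(\<Sum>u\<in>W. \<bar>\<alpha> (fst u)\<bar> * \<bar>\<alpha> (snd u)\<bar>) \<le> 2 / (G * s)" by simp
  then show ?thesis by (simp only: case_prod_unfold \<alpha>_def G_def s_def)
qed

text \<open>
  The quadratic form in the frequencies \<open>\<xi>\<^sub>i + a/r\<close> is summed first over the pairs of fractions, for
  a fixed difference \<open>\<theta>\<close> of two points. The result \<open>K \<theta>\<close> is compared with the kernel of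
  the ordinary large sieve divided by \<open>G\<close>, up to a constant error from pairs of distinct fractions,
  which are grouped according to their difference modulo \<open>1\<close>.
\<close>
lemma enveloping_sieve_bound:
  fixes b :: "'i \<Rightarrow> complex" and \<xi> :: "'i \<Rightarrow> real" and m :: int
  assumes I: "finite I"
    and spaced: "\<And>i j. i \<in> I \<Longrightarrow> j \<in> I \<Longrightarrow> i \<noteq> j \<Longrightarrow> 1 / real H \<le> dist_int (\<xi> i - \<xi> j)"
    and Z: "Z \<ge> 1" "Z ^ 4 \<le> H" and P: "\<And>q. q \<in> P \<Longrightarrow> q > y" and y: "y \<ge> 1"
  shows "(\<Sum>n\<le>H. (cmod ((\<Sum>\<phi>\<in>sieve_freqs P Z. of_real (freq_weight P Z \<phi>) * ee (of_int (m + int n) * freq \<phi>))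
      * (\<Sum>i\<in>I. b i * ee (of_int (m + int n) * \<xi> i))))\<^sup>2)
    \<le> real H / sieve_sum P Z * (3 + 10 * real (card I) / sqrt (real y)) * (\<Sum>i\<in>I. (cmod (b i))\<^sup>2)"
proof -
  define F where "F = sieve_freqs P Z"
  define G where "G = sieve_sum P Z"
  define \<alpha> where "\<alpha> = freq_weight P Z"
  define s where "s = sqrt (real y)"
  have G: "G \<ge> 1" unfolding G_def by (rule sieve_sum_ge_1[OF Z(1)])
  have s: "s > 0" using y by (simp add: s_def)
  have "Z ^ 4 > 0" using Z by simp
  then have H: "H > 0" using Z by linarith
  have finF: "finite F" by (simp add: F_def)
  define K where "K \<theta> = (\<Sum>\<phi>\<in>F. \<Sum>\<phi>'\<in>F. \<bar>\<alpha> \<phi>\<bar> * \<bar>\<alpha> \<phi>'\<bar> * kern H (\<theta> + freq \<phi> - freq \<phi>'))" for \<theta>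
  have K: "K \<theta> \<le> kern H \<theta> / G + 10 * real H / (G * s)" for \<theta>
  proof -
    define h where "h u = \<bar>\<alpha> (fst u)\<bar> * \<bar>\<alpha> (snd u)\<bar> * kern H (\<theta> + freq (fst u) - freq (snd u))" for u
    define g where "g u = frac (freq (fst u) - freq (snd u))" for u
    define E where "E = {u \<in> F \<times> F. fst u \<noteq> snd u}"
    have finE: "finite E" unfolding E_def using finF by auto
    have h_g: "h u = \<bar>\<alpha> (fst u)\<bar> * \<bar>\<alpha> (snd u)\<bar> * kern H (\<theta> + g u)" for u
      using kern_add_int[of H "\<theta> + g u" "\<lfloor>freq (fst u) - freq (snd u)\<rfloor>"]
      by (simp add: h_def g_def frac_def algebra_simps)
    have g_pos: "0 < g u" "g u < 1" if "u \<in> E" for u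
    proof -
      have "g u \<noteq> 0"
      proof
        assume "g u = 0"
        then have "freq (fst u) = freq (snd u) + of_int \<lfloor>freq (fst u) - freq (snd u)\<rfloor>"
          by (simp add: g_def frac_def)
        then have "fst u = snd u"
          by (rule freq_eq_of_int[rotated 2, of _ _ _ P Z]) (use that in \<open>auto simp: E_def F_def\<close>)
        with that show False by (simp add: E_def)
      qed
      then show "0 < g u" "g u < 1" using frac_ge_0[of "freq (fst u) - freq (snd u)"]
        by (auto simp: g_def frac_lt_1)
    qed
    have sep: "1 / real H \<le> dist_int (\<psi> - \<psi>')" if \<psi>: "\<psi> \<in> g ` E" "\<psi>' \<in> g ` E" "\<psi> \<noteq> \<psi>'" for \<psi> \<psi>'
    proof -
      obtain k :: int where k: "dist_int (\<psi> - \<psi>') = \<bar>\<psi> - \<psi>' - of_int k\<bar>" by (rule dist_int_eq_diff_int)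
      have den: "\<exists>q. 0 < q \<and> q \<le> Z ^ 2 \<and> real q * \<psi> \<in> \<int>" if e: "\<psi> \<in> g ` E" for \<psi>
      proof -
        obtain u where u: "u \<in> E" "\<psi> = g u" using e by blast
        have uF: "fst u \<in> sieve_freqs P Z" "snd u \<in> sieve_freqs P Z"
          using u by (auto simp: E_def F_def)
        have 1: "fst (fst u) \<in> {1..Z}" "fst (snd u) \<in> {1..Z}"
          using uF by (auto simp: sieve_freqs_def sieve_moduli_def)
        then have "fst (fst u) * fst (snd u) \<le> Z ^ 2"
          unfolding power2_eq_square by (intro mult_mono) auto
        moreover have "0 < fst (fst u) * fst (snd u)" using 1 by simp
        moreover have "real (fst (fst u) * fst (snd u)) * \<psi> \<in> \<int>"
          unfolding u g_def by (rule denominator_mult_frac_int[OF uF])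
        ultimately show ?thesis by blast
      qed
      obtain q where q: "0 < q" "q \<le> Z ^ 2" "real q * \<psi> \<in> \<int>" using den \<psi> by blast
      obtain q' where q': "0 < q'" "q' \<le> Z ^ 2" "real q' * \<psi>' \<in> \<int>" using den \<psi> by blast
      \<comment> \<open>\<open>D\<close> is a nonzero fraction with denominator \<open>q q'\<close>, hence at least \<open>1/(q q')\<close> in absolute value.\<close>
      define D where "D = \<psi> - \<psi>' - of_int k"
      have "D \<noteq> 0"
      proof
        assume D: "D = 0"
        have "0 < \<psi>" "\<psi> < 1" "0 < \<psi>'" "\<psi>' < 1" using \<psi> g_pos by auto
        then have "\<bar>real_of_int k\<bar> < 1" using D by (simp add: D_def abs_if)
        then have "k = 0" by simp
        with D \<psi> show False by (simp add: D_def)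
      qed
      have "real (q * q') * D = real q' * (real q * \<psi>) - real q * (real q' * \<psi>') - real (q * q') * of_int k"
        by (simp add: D_def algebra_simps)
      also have "\<dots> \<in> \<int>"
        by (intro Ints_diff Ints_mult[OF Ints_of_nat q(3)] Ints_mult[OF Ints_of_nat q'(3)]
            Ints_mult[OF Ints_of_nat Ints_of_int])
      finally obtain l :: int where l: "real (q * q') * D = of_int l" by (auto elim: Ints_cases)
      have "l \<noteq> 0"
      proof
        assume "l = 0"
        with l have "real (q * q') * D = 0" by simp
        with q q' \<open>D \<noteq> 0\<close> show False by simp
      qed
      then have "1 \<le> \<bar>real_of_int l\<bar>" by linarith
      also have "\<dots> = real (q * q') * \<bar>D\<bar>" unfolding l[symmetric] by (simp add: abs_mult)
      also have "\<dots> \<le> real H * \<bar>D\<bar>"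
      proof (rule mult_right_mono)
        have "q * q' \<le> Z ^ 2 * Z ^ 2" using q q' by (intro mult_mono) auto
        also have "\<dots> = Z ^ 4" by (simp flip: power_add)
        also have "\<dots> \<le> H" by (rule Z(2))
        finally show "real (q * q') \<le> real H" by (rule of_nat_mono)
      qed simp
      finally show ?thesis using H k by (simp add: D_def field_simps)
    qed
    \<comment> \<open>The diagonal gives the first summand of the bound; on \<open>E\<close> the kernel depends only on \<open>g u\<close>.\<close>
    have "K \<theta> = (\<Sum>u\<in>F \<times> F. h u)"
      unfolding K_def h_def by (simp add: sum.cartesian_product case_prod_unfold)
    also have "\<dots> = (\<Sum>u\<in>F \<times> F - E. h u) + (\<Sum>u\<in>E. h u)"
      by (rule sum.subset_diff) (use finF in \<open>auto simp: E_def\<close>)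
    also have "(\<Sum>u\<in>F \<times> F - E. h u) = (\<Sum>u\<in>(\<lambda>\<phi>. (\<phi>, \<phi>)) ` F. h u)"
      by (intro sum.cong) (auto simp: E_def)
    also have "\<dots> = (\<Sum>\<phi>\<in>F. (\<alpha> \<phi>)\<^sup>2 * kern H \<theta>)"
      by (subst sum.reindex) (auto intro: inj_onI simp: h_def power2_eq_square)
    also have "\<dots> = kern H \<theta> / G"
      unfolding sum_distrib_right[symmetric] F_def \<alpha>_def sum_freq_weight_squares_all[OF Z(1)] G_def by simp
    also have "(\<Sum>u\<in>E. h u) = (\<Sum>\<psi>\<in>g ` E. \<Sum>u\<in>{u\<in>E. g u = \<psi>}. h u)"
      by (rule sum.image_gen[OF finE])
    also have "\<dots> \<le> (\<Sum>\<psi>\<in>g ` E. 2 / (G * s) * kern H (\<theta> + \<psi>))"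
    proof (intro sum_mono)
      fix \<psi> assume \<psi>: "\<psi> \<in> g ` E"
      have "(\<Sum>u\<in>{u\<in>E. g u = \<psi>}. h u)
          = (\<Sum>(\<phi>, \<phi>')\<in>{u\<in>E. g u = \<psi>}. \<bar>\<alpha> \<phi>\<bar> * \<bar>\<alpha> \<phi>'\<bar>) * kern H (\<theta> + \<psi>)"
        by (simp add: h_g sum_distrib_right case_prod_unfold)
      also have "\<dots> \<le> 2 / (G * s) * kern H (\<theta> + \<psi>)"
        unfolding G_def s_def \<alpha>_def
        by (intro mult_right_mono correlation_le[OF Z(1) P y, where \<psi> = \<psi>] kern_nonneg)
          (use \<psi> g_pos in \<open>auto simp: E_def F_def g_def\<close>)
      finally show "(\<Sum>u\<in>{u\<in>E. g u = \<psi>}. h u) \<le> 2 / (G * s) * kern H (\<theta> + \<psi>)" .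
    qed
    also have "\<dots> = 2 / (G * s) * (\<Sum>\<psi>\<in>g ` E. kern H (\<theta> + \<psi>))"
      by (simp add: sum_distrib_left)
    also have "\<dots> \<le> 2 / (G * s) * (5 * real H)"
    proof (rule mult_left_mono)
      show "(\<Sum>\<psi>\<in>g ` E. kern H (\<theta> + \<psi>)) \<le> 5 * real H"
        using finE sep by (intro sum_kern_le H) auto
    qed (use G s in simp)
    finally show ?thesis by simp
  qed
  define c where "c u = b (fst u) * of_real (\<alpha> (snd u))" for u
  define t where "t u = \<xi> (fst u) + freq (snd u)" for u
  have product: "(\<Sum>\<phi>\<in>F. of_real (\<alpha> \<phi>) * ee (of_int n * freq \<phi>)) * (\<Sum>i\<in>I. b i * ee (of_int n * \<xi> i))
      = (\<Sum>u\<in>I \<times> F. c u * ee (of_int n * t u))" for n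
    by (subst mult.commute)
      (simp add: sum_product sum.cartesian_product case_prod_unfold c_def t_def distrib_left ee_add mult_ac)
  have "(\<Sum>n\<le>H. (cmod ((\<Sum>\<phi>\<in>F. of_real (\<alpha> \<phi>) * ee (of_int (m + int n) * freq \<phi>))
      * (\<Sum>i\<in>I. b i * ee (of_int (m + int n) * \<xi> i))))\<^sup>2)
      = (\<Sum>n\<le>H. (cmod (\<Sum>u\<in>I \<times> F. c u * ee (of_int (m + int n) * t u)))\<^sup>2)"
    by (simp only: product)
  also have "\<dots> \<le> (\<Sum>u\<in>I \<times> F. \<Sum>v\<in>I \<times> F. cmod (c u) * cmod (c v) * kern H (t u - t v))"
    using I finF by (intro mean_square_le_kern H) auto
  also have "\<dots> = (\<Sum>i\<in>I. \<Sum>\<phi>\<in>F. \<Sum>j\<in>I. \<Sum>\<phi>'\<in>F.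
      cmod (b i) * cmod (b j) * (\<bar>\<alpha> \<phi>\<bar> * \<bar>\<alpha> \<phi>'\<bar> * kern H (\<xi> i - \<xi> j + freq \<phi> - freq \<phi>')))"
    by (simp add: sum.cartesian_product' c_def t_def norm_mult algebra_simps)
  also have "\<dots> = (\<Sum>i\<in>I. \<Sum>j\<in>I. cmod (b i) * cmod (b j) * K (\<xi> i - \<xi> j))"
    unfolding K_def sum_distrib_left by (intro sum.cong refl, subst sum.swap) (rule refl)
  also have "\<dots> \<le> (\<Sum>i\<in>I. \<Sum>j\<in>I. cmod (b i) * cmod (b j)
      * (kern H (\<xi> i - \<xi> j) / G + 10 * real H / (G * s)))"
    by (intro sum_mono mult_left_mono K) auto
  also have "\<dots> \<le> (3 * real H / G + real (card I) * (10 * real H / (G * s))) * (\<Sum>i\<in>I. (cmod (b i))\<^sup>2)"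
  proof (rule schur_bound)
    fix i j
    show "0 \<le> kern H (\<xi> i - \<xi> j) / G + 10 * real H / (G * s)"
      using G s kern_nonneg by simp
    show "kern H (\<xi> i - \<xi> j) / G + 10 * real H / (G * s) = kern H (\<xi> j - \<xi> i) / G + 10 * real H / (G * s)"
      using kern_minus[of H "\<xi> j - \<xi> i"] by simp
  next
    fix i assume i: "i \<in> I"
    have "(\<Sum>j\<in>I. kern H (\<xi> i - \<xi> j) / G) \<le> 3 * real H / G"
      unfolding sum_divide_distrib[symmetric]
      using G by (intro divide_right_mono sum_kern_diff_le I H i spaced) auto
    then show "(\<Sum>j\<in>I. kern H (\<xi> i - \<xi> j) / G + 10 * real H / (G * s))
        \<le> 3 * real H / G + real (card I) * (10 * real H / (G * s))"
      by (simp add: sum.distrib)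
  qed
  also have "3 * real H / G + real (card I) * (10 * real H / (G * s))
      = real H / G * (3 + 10 * real (card I) / s)"
    using G s by (simp add: field_simps)
  finally show ?thesis by (simp only: F_def G_def \<alpha>_def s_def)
qed

section \<open>The dual inequality on the circle\<close>

lemma abs_circle_rep: "abs_circle (rep_circle x) = x"
  by (metis Quotient3_abs_rep Quotient3_circle)

lemma e_nat_mult: "e (nat_mult n x) = ee (real n * rep_circle x)"
proof -
  have "e (nat_mult n (abs_circle t)) = ee (real n * t)" for t
    by (simp add: nat_mult.abs_eq e.abs_eq ee_def cis_conv_exp mult_ac)
  from this[of "rep_circle x"] show ?thesis by (simp add: abs_circle_rep)
qed

lemma circle_norm_diff: "circle_norm (x - y) = dist_int (rep_circle x - rep_circle y)"
proof -
  have "circle_norm (abs_circle s - abs_circle t) = dist_int (s - t)" for s t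
    by (simp add: minus_circle.abs_eq circle_norm.abs_eq)
  from this[of "rep_circle x" "rep_circle y"] show ?thesis by (simp add: abs_circle_rep)
qed

text \<open>
  The left-hand side is the total of the estimate below: \<open>4004/1000\<close> comes from \<open>H \<le> 1.001 (N + 1/\<delta>)\<close>
  and \<open>ln Z \<ge> (ln N)/4\<close>, and the summand \<open>1\<close> pays for the primes up to \<open>Z\<close>. For \<open>k \<le> 12\<close> one takes
  \<open>y = 1\<close>, so that the product is empty; for larger \<open>k\<close> the level \<open>y = 100 k\<^sup>2\<close> makes the
  last bracket equal to \<open>4\<close>.
\<close>
lemma exists_sifting_level:
  assumes "k \<ge> 1"
  shows "\<exists>y\<ge>1. 4004 / 1000 * (\<Prod>p\<in>primes_upto y. real p / (real p - 1)) * (3 + 10 * real k / sqrt (real y)) + 1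
    \<le> 280 * ln (2 * real k)"
proof (cases "k \<le> 12")
  case True
  have "primes_upto 1 = {}" by (auto simp: primes_upto_def dest: prime_gt_1_nat)
  moreover have "4004 / 1000 * (3 + 10 * real k) + 1 \<le> 280 * ln (2 * real k)"
  proof (cases "k \<le> 4")
    case True
    have "ln 2 \<le> ln (2 * real k)" using assms by simp
    then have "2 / 3 \<le> ln (2 * real k)" using ln2_ge_two_thirds by linarith
    then have "280 * (2 / 3) \<le> 280 * ln (2 * real k)" by (intro mult_left_mono) auto
    moreover have "4004 / 1000 * (3 + 10 * real k) + 1 \<le> 4004 / 1000 * 43 + 1"
      using True by (intro add_right_mono mult_left_mono) auto
    moreover have "4004 / 1000 * 43 + 1 \<le> 280 * (2 / 3 :: real)" by simp
    ultimately show ?thesis by (meson order_trans)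
  next
    case False
    then have "real k \<ge> 4" by simp
    then have "ln (2 ^ 3) \<le> ln (2 * real k)" by (subst ln_le_cancel_iff) auto
    moreover have "ln (2 ^ 3) = 3 * ln (2::real)" by (subst ln_realpow) auto
    ultimately have "2 \<le> ln (2 * real k)" using ln2_ge_two_thirds by linarith
    then have "280 * 2 \<le> 280 * ln (2 * real k)" by (intro mult_left_mono) auto
    moreover have "4004 / 1000 * (3 + 10 * real k) + 1 \<le> 4004 / 1000 * 123 + 1"
      using \<open>k \<le> 12\<close> by (intro add_right_mono mult_left_mono) auto
    moreover have "4004 / 1000 * 123 + 1 \<le> 280 * (2 :: real)" by simp
    ultimately show ?thesis by (meson order_trans)
  qed
  ultimately show ?thesis by (intro exI[of _ 1]) simp
next
  case False
  define y where "y = (10 * k) ^ 2"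
  define l where "l = ln (2 * real k)"
  define Q where "Q = (\<Prod>p\<in>primes_upto y. real p / (real p - 1))"
  have k: "real k \<ge> 8" using False by simp
  have "ln (2 ^ 4) \<le> l" unfolding l_def using k by (subst ln_le_cancel_iff) auto
  moreover have "ln (2 ^ 4) = 4 * ln (2::real)" by (subst ln_realpow) auto
  ultimately have l: "l \<ge> 8 / 3" using ln2_ge_two_thirds by linarith
  have y: "y \<ge> 1" "y > 0" using assms by (auto simp: y_def)
  have "ln (real y) + ln 4 = ln (real y * 4)" using y by (subst ln_mult) auto
  also have "real y * 4 = 100 * (2 * real k)\<^sup>2" by (simp add: y_def power_mult_distrib)
  also have "ln (100 * (2 * real k)\<^sup>2) = ln 100 + ln ((2 * real k)\<^sup>2)"
    using assms by (subst ln_mult) auto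
  also have "ln ((2 * real k)\<^sup>2) = 2 * l"
    unfolding l_def using assms by (subst ln_realpow) auto
  \<comment> \<open>\<open>100 \<le> 128\<close> reduces the numerical estimate to the known bounds for \<open>ln 2\<close>.\<close>
  also have "ln 100 \<le> ln ((2::real) ^ 7)" by (subst ln_le_cancel_iff) auto
  also have "ln ((2::real) ^ 7) = 7 * ln 2" by (subst ln_realpow) auto
  also have "\<dots> \<le> 49 / 10" using ln2_le_25_over_36 by simp
  finally have ln_y: "ln (real y) + ln 4 + 3 \<le> 2 * l + 79 / 10" by simp
  have "Q \<le> exp 1 * (ln (real y) + ln 4 + 3)"
    unfolding Q_def by (rule mertens_product_le) (use y in simp)
  also have "\<dots> \<le> 3 * (2 * l + 79 / 10)"
    using ln_y exp_le y by (intro mult_mono) (auto intro!: add_nonneg_nonneg ln_ge_zero)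
  finally have "Q \<le> 6 * l + 237 / 10" by simp
  then have budget: "4004 / 1000 * Q * 4 + 1 \<le> 280 * l" using l by linarith
  have "sqrt (real y) = 10 * real k" by (simp add: y_def real_sqrt_mult)
  then have "3 + 10 * real k / sqrt (real y) = 4" using assms by simp
  then have "4004 / 1000 * Q * (3 + 10 * real k / sqrt (real y)) + 1 \<le> 280 * l"
    using budget by (simp only:)
  with y(1) show ?thesis unfolding Q_def l_def by blast
qed

lemma norm_sum_squared_le:
  fixes b w :: "'i \<Rightarrow> complex"
  assumes "\<And>i. i \<in> I \<Longrightarrow> cmod (w i) = 1"
  shows "(cmod (\<Sum>i\<in>I. b i * w i))\<^sup>2 \<le> real (card I) * (\<Sum>i\<in>I. (cmod (b i))\<^sup>2)"
proof -
  have "cmod (\<Sum>i\<in>I. b i * w i) \<le> (\<Sum>i\<in>I. cmod (b i))"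
    by (intro sum_norm_le) (simp add: norm_mult assms)
  then have "(cmod (\<Sum>i\<in>I. b i * w i))\<^sup>2 \<le> (\<Sum>i\<in>I. cmod (b i))\<^sup>2"
    by (intro power_mono) auto
  also have "\<dots> \<le> real (card I) * (\<Sum>i\<in>I. (cmod (b i))\<^sup>2)"
    using sum_squared_le_sum_of_squares[of "\<lambda>i. cmod (b i)" I] by (simp add: mult.commute)
  finally show ?thesis .
qed

text \<open>
  If \<open>ln (2 k)\<close> is not much smaller than \<open>ln N\<close>, the large sieve over all integers of the window
  suffices. Otherwise \<open>2 k \<le> N\<^bsup>1/4\<^esup>\<close>; the primes above \<open>Z\<close> are treated by the enveloping sieve, and
  the at most \<open>Z\<close> remaining ones by the trivial bound \<open>Z k \<le> (\<surd>N)/2\<close>.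
\<close>
lemma dual_inequality:
  fixes b :: "'i \<Rightarrow> complex" and \<xi> :: "'i \<Rightarrow> real"
  assumes \<delta>: "\<delta> > 0" and I: "finite I" "I \<noteq> {}"
    and spaced: "\<And>i j. i \<in> I \<Longrightarrow> j \<in> I \<Longrightarrow> i \<noteq> j \<Longrightarrow> \<delta> \<le> dist_int (\<xi> i - \<xi> j)"
    and N: "N \<ge> 1000" and M: "M \<ge> 0"
  shows "(\<Sum>p\<in>primes_between (M + 1) (M + N). (cmod (\<Sum>i\<in>I. b i * ee (real p * \<xi> i)))\<^sup>2)
    \<le> 280 * ((N + inverse \<delta>) / ln N) * ln (2 * real (card I)) * (\<Sum>i\<in>I. (cmod (b i))\<^sup>2)"
proof -
  define T where "T = N + inverse \<delta>"
  define H where "H = nat \<lceil>T\<rceil>"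
  define m where "m = \<lfloor>M + 1\<rfloor>"
  define k where "k = card I"
  define l where "l = ln (2 * real k)"
  define nb where "nb = (\<Sum>i\<in>I. (cmod (b i))\<^sup>2)"
  define B where "B n = (\<Sum>i\<in>I. b i * ee (of_int n * \<xi> i))" for n :: int
  define PB where "PB = primes_between (M + 1) (M + N)"
  have nb: "nb \<ge> 0" by (simp add: nb_def sum_nonneg)
  have "inverse \<delta> > 0" using \<delta> by simp
  then have T: "N \<le> T" "T \<ge> 1000" "inverse \<delta> \<le> T" using N unfolding T_def by linarith+
  have H: "T \<le> real H" "real H \<le> 1001 / 1000 * T"
    unfolding H_def using T by linarith+
  have H0: "H > 0" using H T by linarith
  have k: "k \<ge> 1" using I by (simp add: k_def Suc_le_eq card_gt_0_iff)
  have l0: "l > 0" using k by (simp add: l_def)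
  have lnN: "ln N > 0" using N by simp
  have spaced': "1 / real H \<le> dist_int (\<xi> i - \<xi> j)" if "i \<in> I" "j \<in> I" "i \<noteq> j" for i j
  proof -
    have "inverse \<delta> \<le> real H" using H T by linarith
    then have "1 / real H \<le> \<delta>" using \<delta> H0 by (simp add: field_simps)
    then show ?thesis using spaced[OF that] by linarith
  qed
  have finPB: "finite PB" unfolding PB_def by (rule finite_primes_between)
  \<comment> \<open>The primes lie in the window \<open>m, \<dots>, m + H\<close>, as \<open>m \<le> M + 1 < m + 1\<close> and \<open>H \<ge> N\<close>.\<close>
  have window: "\<exists>n\<le>H. int p = m + int n" if "p \<in> PB" for p
  proof -
    have p: "M + 1 \<le> real p" "real p \<le> M + N" using that by (auto simp: PB_def primes_between_def)
    have "m \<le> int p" using p(1) unfolding m_def by linarith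
    moreover have "real_of_int (int p - m) \<le> real H"
      using p(2) H T unfolding m_def by linarith
    ultimately show ?thesis by (intro exI[of _ "nat (int p - m)"]) linarith
  qed
  have sum_window: "(\<Sum>p\<in>V. g (int p)) \<le> (\<Sum>n\<le>H. g (m + int n))"
    if V: "V \<subseteq> PB" and g: "\<And>n. g n \<ge> 0" for V and g :: "int \<Rightarrow> real"
  proof -
    have "(\<Sum>p\<in>V. g (int p)) = (\<Sum>n\<in>int ` V. g n)" by (subst sum.reindex) auto
    also have "\<dots> \<le> (\<Sum>n\<in>(\<lambda>n. m + int n) ` {..H}. g n)"
      using V window g by (intro sum_mono2) fastforce+
    also have "\<dots> = (\<Sum>n\<le>H. g (m + int n))" by (subst sum.reindex) (auto intro: inj_onI)
    finally show ?thesis .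
  qed
  have "(\<Sum>p\<in>PB. (cmod (B (int p)))\<^sup>2) \<le> 280 * (T / ln N) * l * nb"
  proof (cases "3003 / 1000 * ln N \<le> 280 * l")
    case True
    have "(\<Sum>p\<in>PB. (cmod (B (int p)))\<^sup>2) \<le> (\<Sum>n\<le>H. (cmod (B (m + int n)))\<^sup>2)"
      by (rule sum_window) auto
    also have "\<dots> \<le> 3 * real H * nb"
      unfolding B_def nb_def by (rule large_sieve[OF I(1) H0 spaced'])
    also have "\<dots> \<le> 280 * (T / ln N) * l * nb"
    proof (rule mult_right_mono[OF _ nb])
      have "3 * real H * ln N \<le> 3003 / 1000 * T * ln N"
        using H lnN by (intro mult_right_mono) auto
      also have "\<dots> = T * (3003 / 1000 * ln N)" by simp
      also have "\<dots> \<le> T * (280 * l)" using True T by (intro mult_left_mono) auto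
      finally show "3 * real H \<le> 280 * (T / ln N) * l" using lnN by (simp add: field_simps)
    qed
    finally show ?thesis .
  next
    case False
    obtain y where y: "y \<ge> 1" and budget:
      "4004 / 1000 * (\<Prod>p\<in>primes_upto y. real p / (real p - 1)) * (3 + 10 * real k / sqrt (real y)) + 1 \<le> 280 * l"
      using exists_sifting_level[OF k] unfolding l_def by blast
    define Q where "Q = (\<Prod>p\<in>primes_upto y. real p / (real p - 1))"
    define Z where "Z = nat \<lfloor>N powr (1 / 4)\<rfloor>"
    define P where "P = primes_upto Z - primes_upto y"
    define G where "G = sieve_sum P Z"
    define C where "C = 3 + 10 * real k / sqrt (real y)"
    have root: "N powr (1 / 4) \<ge> 1" using N by (simp add: ge_one_powr_ge_zero)
    have Z1: "Z \<ge> 1" unfolding Z_def using root by (simp add: le_nat_iff)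
    have Z_le: "real Z \<le> N powr (1 / 4)" unfolding Z_def using root by simp
    have Z_gt: "N powr (1 / 4) \<le> real Z + 1" unfolding Z_def using root by linarith
    have root4: "(N powr (1 / 4)) ^ 4 = N"
      using N by (simp add: powr_powr flip: powr_realpow)
    have "real (Z ^ 4) \<le> (N powr (1 / 4)) ^ 4"
      using Z_le by (simp add: power_mono)
    then have "real (Z ^ 4) \<le> real H" using root4 H T by linarith
    then have Z4: "Z ^ 4 \<le> H" by (simp only: of_nat_le_iff)
    have G1: "G \<ge> 1" unfolding G_def by (rule sieve_sum_ge_1[OF Z1])
    have C: "C \<ge> 3" by (simp add: C_def)
    have "ln N / 4 = ln (N powr (1 / 4))" using N by (simp add: ln_powr)
    also have "\<dots> \<le> ln (real Z + 1)" using Z_gt root by (subst ln_le_cancel_iff) auto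
    also have "\<dots> \<le> Q * G" unfolding Q_def G_def P_def by (rule ln_le_sieve_sum)
    finally have "1 / G \<le> 4 * Q / ln N" using G1 lnN by (simp add: field_simps)
    then have HG: "real H / G * C \<le> 4004 / 1000 * Q * C * (T / ln N)"
    proof -
      assume *: "1 / G \<le> 4 * Q / ln N"
      have "real H * (1 / G) * C \<le> (1001 / 1000 * T) * (4 * Q / ln N) * C"
        using * H T G1 C by (intro mult_right_mono mult_mono) auto
      then show ?thesis by (simp add: mult_ac)
    qed
    have "(\<Sum>p\<in>{p\<in>PB. p > Z}. (cmod (B (int p)))\<^sup>2) \<le> real H / G * C * nb"
    proof -
      define A where "A n = (\<Sum>\<phi>\<in>sieve_freqs P Z. of_real (freq_weight P Z \<phi>) * ee (of_int n * freq \<phi>))" for n :: int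
      have "A (int p) = 1" if p: "p \<in> PB" "p > Z" for p
        unfolding A_def
      proof (rule sieve_weight_polynomial_eq_1[OF Z1])
        fix r assume "r \<in> sieve_moduli P Z"
        then have "0 < r" "r < p" using p by (auto simp: sieve_moduli_def)
        then have "\<not> p dvd r" by (auto dest: dvd_imp_le)
        moreover have "prime p" using p by (simp add: PB_def primes_between_def)
        ultimately show "coprime (int p) (int r)" by (simp add: prime_imp_coprime)
      qed
      then have "(\<Sum>p\<in>{p\<in>PB. p > Z}. (cmod (B (int p)))\<^sup>2)
          = (\<Sum>p\<in>{p\<in>PB. p > Z}. (cmod (A (int p) * B (int p)))\<^sup>2)" by simp
      also have "\<dots> \<le> (\<Sum>n\<le>H. (cmod (A (m + int n) * B (m + int n)))\<^sup>2)"
        by (rule sum_window) auto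
      also have "\<dots> \<le> real H / G * C * nb"
        unfolding A_def B_def G_def C_def nb_def k_def
        by (rule enveloping_sieve_bound[OF I(1) spaced' Z1 Z4 _ y])
          (auto simp: P_def primes_upto_def)
      finally show ?thesis .
    qed
    also have "\<dots> \<le> 4004 / 1000 * Q * C * (T / ln N) * nb"
      by (rule mult_right_mono[OF HG nb])
    finally have large: "(\<Sum>p\<in>{p\<in>PB. p > Z}. (cmod (B (int p)))\<^sup>2)
        \<le> 4004 / 1000 * Q * C * (T / ln N) * nb" .
    have small: "(\<Sum>p\<in>{p\<in>PB. p \<le> Z}. (cmod (B (int p)))\<^sup>2) \<le> T / ln N * nb"
    proof -
      have "{p\<in>PB. p \<le> Z} \<subseteq> {1..Z}"
        by (auto simp: PB_def primes_between_def dest: prime_gt_0_nat)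
      then have card: "card {p\<in>PB. p \<le> Z} \<le> Z" using card_mono[of "{1..Z}"] by fastforce
      have "(\<Sum>p\<in>{p\<in>PB. p \<le> Z}. (cmod (B (int p)))\<^sup>2)
          \<le> real (card {p\<in>PB. p \<le> Z}) * (real k * nb)"
        unfolding B_def k_def nb_def by (intro sum_bounded_above norm_sum_squared_le) simp
      also have "\<dots> \<le> real Z * (real k * nb)"
        using card nb by (intro mult_right_mono) auto
      also have "\<dots> = (real Z * real k) * nb" by simp
      also have "\<dots> \<le> T / ln N * nb"
      proof (rule mult_right_mono[OF _ nb])
        have "l \<le> ln N / 4" using False l0 lnN by linarith
        then have "exp l \<le> exp (ln N / 4)" by simp
        then have "2 * real k \<le> N powr (1 / 4)" using k N by (simp add: l_def powr_def)
        then have "2 * (real Z * real k) \<le> N powr (1 / 4) * N powr (1 / 4)"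
          using mult_mono[OF Z_le, of "2 * real k" "N powr (1 / 4)"] by simp
        also have "\<dots> = sqrt N" using N by (simp add: powr_half_sqrt flip: powr_add)
        finally have Zk: "2 * (real Z * real k) \<le> sqrt N" .
        have "ln N = 2 * ln (sqrt N)" using N by (simp add: ln_sqrt)
        also have "\<dots> \<le> 2 * sqrt N"
          using ln_le_minus_one[of "sqrt N"] N by simp
        finally have "(2 * (real Z * real k)) * ln N \<le> sqrt N * (2 * sqrt N)"
          using Zk lnN N by (intro mult_mono) auto
        then have "real Z * real k * ln N \<le> N" using N by simp
        then have "real Z * real k * ln N \<le> T" using T by linarith
        then show "real Z * real k \<le> T / ln N" using lnN by (simp add: field_simps)
      qed
      finally show ?thesis .
    qed
    have "(\<Sum>p\<in>PB. (cmod (B (int p)))\<^sup>2)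
        = (\<Sum>p\<in>PB - {p\<in>PB. p \<le> Z}. (cmod (B (int p)))\<^sup>2) + (\<Sum>p\<in>{p\<in>PB. p \<le> Z}. (cmod (B (int p)))\<^sup>2)"
      using finPB by (intro sum.subset_diff) auto
    also have "PB - {p\<in>PB. p \<le> Z} = {p\<in>PB. p > Z}" by auto
    finally have "(\<Sum>p\<in>PB. (cmod (B (int p)))\<^sup>2)
        \<le> 4004 / 1000 * Q * C * (T / ln N) * nb + T / ln N * nb"
      using large small by linarith
    also have "\<dots> = (4004 / 1000 * Q * C + 1) * (T / ln N * nb)" by (simp add: algebra_simps)
    also have "\<dots> \<le> (280 * l) * (T / ln N * nb)"
      using budget T lnN nb by (intro mult_right_mono) (auto simp: Q_def C_def)
    finally show ?thesis by (simp add: mult_ac)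
  qed
  then show ?thesis by (simp add: PB_def B_def T_def l_def k_def nb_def)
qed

text \<open>
  A matrix and its transpose have the same norm: choosing for \<open>b\<close> the conjugates of the sums \<open>S i\<close> and
  applying the inequality of Cauchy and Schwarz gives \<open>V\<^sup>2 \<le> D U V\<close>.
\<close>
lemma duality:
  fixes w :: "'p \<Rightarrow> 'i \<Rightarrow> complex"
  assumes "D \<ge> 0" and dual: "\<And>b :: 'i \<Rightarrow> complex.
      (\<Sum>p\<in>J. (cmod (\<Sum>i\<in>I. b i * w p i))\<^sup>2) \<le> D * (\<Sum>i\<in>I. (cmod (b i))\<^sup>2)"
  shows "(\<Sum>i\<in>I. (cmod (\<Sum>p\<in>J. u p * w p i))\<^sup>2) \<le> D * (\<Sum>p\<in>J. (cmod (u p))\<^sup>2)"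
proof -
  define S where "S i = (\<Sum>p\<in>J. u p * w p i)" for i
  define V where "V = (\<Sum>i\<in>I. (cmod (S i))\<^sup>2)"
  define U where "U = (\<Sum>p\<in>J. (cmod (u p))\<^sup>2)"
  define b where "b i = cnj (S i)" for i
  have V0: "V \<ge> 0" and U0: "U \<ge> 0" by (simp_all add: V_def U_def sum_nonneg)
  have "complex_of_real V = (\<Sum>i\<in>I. S i * cnj (S i))"
    unfolding V_def by (simp only: of_real_sum complex_norm_square)
  also have "\<dots> = (\<Sum>i\<in>I. \<Sum>p\<in>J. u p * (b i * w p i))"
    by (intro sum.cong refl) (simp add: b_def S_def[of _] sum_distrib_right mult_ac)
  also have "\<dots> = (\<Sum>p\<in>J. u p * (\<Sum>i\<in>I. b i * w p i))"
    by (subst sum.swap) (simp add: sum_distrib_left)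
  finally have eq: "complex_of_real V = (\<Sum>p\<in>J. u p * (\<Sum>i\<in>I. b i * w p i))" .
  have "V = cmod (complex_of_real V)" using V0 by simp
  also have "\<dots> \<le> (\<Sum>p\<in>J. \<bar>cmod (u p) * cmod (\<Sum>i\<in>I. b i * w p i)\<bar>)"
    unfolding eq by (intro sum_norm_le) (simp add: norm_mult)
  also have "\<dots> = (\<Sum>p\<in>J. cmod (u p) * cmod (\<Sum>i\<in>I. b i * w p i))" by simp
  finally have "V\<^sup>2 \<le> (\<Sum>p\<in>J. cmod (u p) * cmod (\<Sum>i\<in>I. b i * w p i))\<^sup>2"
    using V0 by (intro power_mono)
  also have "\<dots> \<le> U * (\<Sum>p\<in>J. (cmod (\<Sum>i\<in>I. b i * w p i))\<^sup>2)"
    unfolding U_def by (rule Cauchy_Schwarz_ineq_sum)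
  also have "\<dots> \<le> U * (D * (\<Sum>i\<in>I. (cmod (b i))\<^sup>2))"
    by (intro mult_left_mono dual U0)
  also have "(\<Sum>i\<in>I. (cmod (b i))\<^sup>2) = V" by (simp add: b_def V_def)
  finally have le: "V * V \<le> (D * U) * V" by (simp add: power2_eq_square mult_ac)
  have "V \<le> D * U"
  proof (cases "V = 0")
    case False
    with V0 have "V > 0" by simp
    with le show ?thesis by (rule mult_right_le_imp_le)
  next
    case True
    then show ?thesis using assms(1) U0 by simp
  qed
  then show ?thesis by (simp add: V_def S_def U_def)
qed

theorem theorem10p5:
  fixes \<delta> N M :: real and X :: "circle set" and u :: "nat \<Rightarrow> complex"
  assumes "\<delta> > 0" and "X \<noteq> {}" and "well_spaced \<delta> X"
    and "N \<ge> 1000" and "M \<ge> 0"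
  shows "(\<Sum>x\<in>X. (cmod (\<Sum>p\<in>primes_between (M + 1) (M + N). u p * e (nat_mult p x)))\<^sup>2)
    \<le> 280 * ((N + inverse \<delta>) / ln N)
        * (\<Sum>p\<in>primes_between (M + 1) (M + N). (cmod (u p))\<^sup>2) * ln (2 * real (card X))"
proof -
  have fin: "finite X" by (rule well_spaced_finite[OF assms(1,3)])
  have spaced: "\<delta> \<le> dist_int (rep_circle x - rep_circle y)" if "x \<in> X" "y \<in> X" "x \<noteq> y" for x y
    using assms(3) that by (simp add: well_spaced_def circle_norm_diff)
  have "(\<Sum>x\<in>X. (cmod (\<Sum>p\<in>primes_between (M + 1) (M + N). u p * ee (real p * rep_circle x)))\<^sup>2)
    \<le> 280 * ((N + inverse \<delta>) / ln N) * ln (2 * real (card X))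
        * (\<Sum>p\<in>primes_between (M + 1) (M + N). (cmod (u p))\<^sup>2)"
  proof (rule duality)
    have "card X \<ge> 1" using fin assms(2) by (simp add: Suc_le_eq card_gt_0_iff)
    then show "0 \<le> 280 * ((N + inverse \<delta>) / ln N) * ln (2 * real (card X))"
      using assms by (intro mult_nonneg_nonneg divide_nonneg_nonneg) auto
  next
    fix b :: "circle \<Rightarrow> complex"
    show "(\<Sum>p\<in>primes_between (M + 1) (M + N). (cmod (\<Sum>x\<in>X. b x * ee (real p * rep_circle x)))\<^sup>2)
        \<le> 280 * ((N + inverse \<delta>) / ln N) * ln (2 * real (card X)) * (\<Sum>x\<in>X. (cmod (b x))\<^sup>2)"
      by (rule dual_inequality[OF assms(1) fin assms(2) spaced assms(4,5)])
  qed
  then show ?thesis by (simp add: e_nat_mult mult_ac)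
qed

end
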